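(* Let $\mathcal M$ be a computational model in which the keyed hash function $\mathsf H$ is collision resistant under hidden-key attacks (CR-HK). Let $\mathsf k$ be a name and let $t,t',\vec u$ be ground terms in which $\mathsf k$ occurs only as second argument of $\mathsf H$. Then $$\mathcal M\models\ \vec u,\ \mathsf{if}\ \mathsf{EQ}(t;t')\ \mathsf{then}\ \mathsf{false}\ \mathsf{else}\ \mathsf{EQ}(\mathsf H(t,\mathsf k);\mathsf H(t',\mathsf k))\ \sim\ \vec u,\ \mathsf{false}.$$
   Context: Syntax. Terms are built from a countable set of names (sort $\mathsf{Nonce}$), a set $\mathcal F$ of function symbols, and a set $\mathcal G$ of attacker function symbols. Sorts are $\mathsf{bool}$, $\mathsf{Nonce}$, $\mathsf{term}$, with $\mathsf{bool},\mathsf{Nonce}<\mathsf{term}$. $\mathcal F$ contains at least $\mathsf H:\mathsf{term}\times\mathsf{Nonce}\to\mathsf{Nonce}$, $\oplus:\mathsf{Nonce}\times\mathsf{Nonce}\to\mathsf{Nonce}$, pairing $\langle\_,\_\rangle$, projections $\pi_1,\pi_2$, $\mathsf{EQ}(\_;\_):\mathsf{term}\times\mathsf{term}\to\mathsf{bool}$, $\mathsf{if\,then\,else}$, $\mathsf{true},\mathsf{false}$, $\mathbf 0:\ \to\mathsf{Nonce}$. Computational models. For each security parameter $\eta$ and pair of infinite random tapes $\rho_1$ (honest), $\rho_2$ (attacker), a ground term $t$ is interpreted as a bitstring $[\![t]\!]_{\eta,\rho_1,\rho_2}$: names are blocks of $\eta$ bits of $\rho_1$, distinct names using disjoint blocks;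 $\mathsf{true},\mathsf{false},\mathsf{EQ}$ (equality of bitstrings), $\mathsf{if\,then\,else}$, $\oplus$ (bitwise xor), $\mathbf 0$ ($0^\eta$) have their expected meaning; every other $f\in\mathcal F$ is a deterministic polynomial-time function of $1^\eta$ and the argument values, respecting sorts ($\mathsf{Nonce}$ = bitstrings of length $\eta$); each $g\in\mathcal G$ is a polynomial-time machine applied to $1^\eta$, the argument values and $\rho_2$, with no access to $\rho_1$. $\vec u\sim\vec v$ holds iff for every deterministic polynomial-time $\mathcal A$, $|\Pr_{\rho_1,\rho_2}(\mathcal A([\![\vec u]\!],1^\eta,\rho_2)=1)-\Pr_{\rho_1,\rho_2}(\mathcal A([\![\vec v]\!],1^\eta,\rho_2)=1)|$ is negligible in $\eta$. CR-HK. $\mathsf H$ is collision resistant under hidden-key attacks if for every probabilistic polynomial-time adversary $\mathcal A$ with oracle access to $\mathsf H(\cdot,k)$, the probability, over $k$ uniform in $\{0,1\}^\eta$ and the random tape of $\mathcal A$, that $\mathcal A^{\mathsf H(\cdot,k)}(1^\eta)$ outputs a pair $\langle m_1,m_2\rangle$ with $m_1\ne m_2$ and $\mathsf H(m_1,k)=\mathsf H(m_2,k)$ is negligible in $\eta$. *)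

theory Defs
  imports "HOL-Probability.Probability" "HOL-Computational_Algebra.Polynomial"
begin

datatype srt = BoolS | NonceS | TermS

datatype 'f fsym =
    TrueF | FalseF | ZeroF | EqF | IteF | XorF
  | HashF | PairF | Proj1F | Proj2F | Other 'f

text \<open>Names are drawn from \<open>'n\<close>, further symbols of \<open>\<F>\<close> from \<open>'f\<close>, and the attacker symbols
  \<open>\<G>\<close> from \<open>'g\<close>. There are no variables: every term is ground.\<close>

datatype ('n, 'f, 'g) trm =
    Name 'n
  | Fun "'f fsym" "('n, 'f, 'g) trm list"
  | Att 'g "('n, 'f, 'g) trm list"

abbreviation "FalseT \<equiv> Fun FalseF []"
abbreviation "EqT s t \<equiv> Fun EqF [s, t]"
abbreviation "IteT b s t \<equiv> Fun IteF [b, s, t]"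
abbreviation "HashT s t \<equiv> Fun HashF [s, t]"

type_synonym profile = "srt list \<times> srt"

record ('f, 'g) signature =
  other_profile :: "'f \<Rightarrow> profile"
  att_profile :: "'g \<Rightarrow> profile"

fun fsym_profiles :: "('f, 'g) signature \<Rightarrow> 'f fsym \<Rightarrow> profile set" where
  "fsym_profiles S TrueF = {([], BoolS)}"
| "fsym_profiles S FalseF = {([], BoolS)}"
| "fsym_profiles S ZeroF = {([], NonceS)}"
| "fsym_profiles S EqF = {([TermS, TermS], BoolS)}"
| "fsym_profiles S IteF = {([BoolS, s, s], s) |s. True}"
| "fsym_profiles S XorF = {([NonceS, NonceS], NonceS)}"
| "fsym_profiles S HashF = {([TermS, NonceS], NonceS)}"
| "fsym_profiles S PairF = {([TermS, TermS], TermS)}"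
| "fsym_profiles S Proj1F = {([TermS], TermS)}"
| "fsym_profiles S Proj2F = {([TermS], TermS)}"
| "fsym_profiles S (Other f) = {other_profile S f}"

inductive has_sort :: "('f, 'g) signature \<Rightarrow> ('n, 'f, 'g) trm \<Rightarrow> srt \<Rightarrow> bool"
  for S :: "('f, 'g) signature" where
  Name: "has_sort S (Name n) NonceS"
| Fun: "(ss, s) \<in> fsym_profiles S f \<Longrightarrow> list_all2 (has_sort S) ts ss \<Longrightarrow> has_sort S (Fun f ts) s"
| Att: "att_profile S g = (ss, s) \<Longrightarrow> list_all2 (has_sort S) ts ss \<Longrightarrow> has_sort S (Att g ts) s"
| Subsort: "has_sort S t s \<Longrightarrow> has_sort S t TermS"

inductive only_hash_key :: "'n \<Rightarrow> ('n, 'f, 'g) trm \<Rightarrow> bool" for k :: 'n where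
  Name: "n \<noteq> k \<Longrightarrow> only_hash_key k (Name n)"
| Key: "only_hash_key k t \<Longrightarrow> only_hash_key k (HashT t (Name k))"
| Fun: "\<forall>t\<in>set ts. only_hash_key k t \<Longrightarrow> only_hash_key k (Fun f ts)"
| Att: "\<forall>t\<in>set ts. only_hash_key k t \<Longrightarrow> only_hash_key k (Att g ts)"

text \<open>Machines have a finite program, finitely many stacks of bits in use, a read-only infinite
  random tape and an oracle, and each instruction costs one step. A Turing machine tape is a pair of
  stacks and a stack is a tape, so polynomial time here is that of multitape Turing machines.
  The head of a list is the top of the stack.

  \<open>Branch i a b c\<close> continues at address \<open>a\<close> if stack \<open>i\<close> is empty, at \<open>b\<close> if its top bit is 0, and
  at \<open>c\<close> if its top bit is 1. \<open>Coin i\<close> pushes the next bit of the random tape on stack \<open>i\<close>,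
  \<open>Rewind\<close> returns to the start of that tape, and \<open>Query i j\<close> puts the answer of the
  oracle to the content of stack \<open>i\<close> in place of stack \<open>j\<close>. A machine halts when it leaves its
  program.\<close>

type_synonym bits = "bool list"
type_synonym tape = "nat \<Rightarrow> bool"

datatype instr =
    Push nat bool
  | Pop nat
  | Branch nat nat nat nat
  | Coin nat
  | Rewind
  | Query nat nat

record config =
  pc :: nat
  head :: nat
  stack :: "nat \<Rightarrow> bits"

fun exec_instr :: "(bits \<Rightarrow> bits) \<Rightarrow> tape \<Rightarrow> instr \<Rightarrow> config \<Rightarrow> config" where
  "exec_instr orc \<rho> (Push i b) c =
     c\<lparr>pc := Suc (pc c), stack := (stack c)(i := b # stack c i)\<rparr>"
| "exec_instr orc \<rho> (Pop i) c =
     c\<lparr>pc := Suc (pc c), stack := (stack c)(i := tl (stack c i))\<rparr>"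
| "exec_instr orc \<rho> (Branch i l0 l1 l2) c =
     c\<lparr>pc := (case stack c i of [] \<Rightarrow> l0 | b # _ \<Rightarrow> if b then l2 else l1)\<rparr>"
| "exec_instr orc \<rho> (Coin i) c =
     c\<lparr>pc := Suc (pc c), head := Suc (head c), stack := (stack c)(i := \<rho> (head c) # stack c i)\<rparr>"
| "exec_instr orc \<rho> Rewind c = c\<lparr>pc := Suc (pc c), head := 0\<rparr>"
| "exec_instr orc \<rho> (Query i j) c =
     c\<lparr>pc := Suc (pc c), stack := (stack c)(j := orc (stack c i))\<rparr>"

definition step :: "(bits \<Rightarrow> bits) \<Rightarrow> tape \<Rightarrow> instr list \<Rightarrow> config \<Rightarrow> config" where
  "step orc \<rho> P c = (if pc c < length P then exec_instr orc \<rho> (P ! pc c) c else c)"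

text \<open>The input consists of \<open>1\<^sup>\<eta>\<close> on stack 0 and the arguments on the following stacks.\<close>

definition init :: "nat \<Rightarrow> bits list \<Rightarrow> config" where
  "init \<eta> xs = \<lparr>pc = 0, head = 0,
     stack = (\<lambda>i. if i \<le> length xs then (replicate \<eta> True # xs) ! i else [])\<rparr>"

definition halts_with ::
  "(bits \<Rightarrow> bits) \<Rightarrow> tape \<Rightarrow> instr list \<Rightarrow> nat \<Rightarrow> bits list \<Rightarrow> nat \<Rightarrow> (nat \<Rightarrow> bits) \<Rightarrow> bool" where
  "halts_with orc \<rho> P \<eta> xs T st \<longleftrightarrow>
     (let c = (step orc \<rho> P ^^ T) (init \<eta> xs) in length P \<le> pc c \<and> stack c = st)"

definition input_size :: "nat \<Rightarrow> bits list \<Rightarrow> nat" where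
  "input_size \<eta> xs = \<eta> + sum_list (map length xs)"

definition oracle_free :: "instr list \<Rightarrow> bool" where
  "oracle_free P \<longleftrightarrow> (\<forall>i j. Query i j \<notin> set P)"

definition coin_free :: "instr list \<Rightarrow> bool" where
  "coin_free P \<longleftrightarrow> (\<forall>i. Coin i \<notin> set P)"

text \<open>\<open>D \<eta>\<close> is the set of argument lists on which the function is to be computed. The oracle and,
  for deterministic functions, the tape passed to \<open>halts_with\<close> are never consulted.\<close>

definition poly_time :: "(nat \<Rightarrow> bits list set) \<Rightarrow> (nat \<Rightarrow> bits list \<Rightarrow> bits) \<Rightarrow> bool" where
  "poly_time D f \<longleftrightarrow> (\<exists>P (p :: nat poly). oracle_free P \<and> coin_free P \<and>
     (\<forall>\<eta>. \<forall>xs \<in> D \<eta>. \<exists>st.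
        halts_with (\<lambda>_. []) (\<lambda>_. False) P \<eta> xs (poly p (input_size \<eta> xs)) st \<and> st 0 = f \<eta> xs))"

definition poly_time_tape ::
  "(nat \<Rightarrow> bits list set) \<Rightarrow> (nat \<Rightarrow> bits list \<Rightarrow> tape \<Rightarrow> bits) \<Rightarrow> bool" where
  "poly_time_tape D f \<longleftrightarrow> (\<exists>P (p :: nat poly). oracle_free P \<and>
     (\<forall>\<eta> \<rho>. \<forall>xs \<in> D \<eta>. \<exists>st.
        halts_with (\<lambda>_. []) \<rho> P \<eta> xs (poly p (input_size \<eta> xs)) st \<and> st 0 = f \<eta> xs \<rho>))"

record ('n, 'f, 'g) model =
  name_pos :: "nat \<Rightarrow> 'n \<Rightarrow> nat"
  fun_int :: "'f fsym \<Rightarrow> nat \<Rightarrow> bits list \<Rightarrow> bits"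
  att_int :: "'g \<Rightarrow> nat \<Rightarrow> bits list \<Rightarrow> tape \<Rightarrow> bits"

definition name_block :: "('n, 'f, 'g) model \<Rightarrow> nat \<Rightarrow> 'n \<Rightarrow> nat list" where
  "name_block M \<eta> n = [name_pos M \<eta> n ..< name_pos M \<eta> n + \<eta>]"

fun sort_dom :: "nat \<Rightarrow> srt \<Rightarrow> bits set" where
  "sort_dom \<eta> BoolS = {[True], [False]}"
| "sort_dom \<eta> NonceS = {w. length w = \<eta>}"
| "sort_dom \<eta> TermS = UNIV"

definition args_dom :: "srt list \<Rightarrow> nat \<Rightarrow> bits list set" where
  "args_dom ss \<eta> = {xs. list_all2 (\<lambda>x s. x \<in> sort_dom \<eta> s) xs ss}"

definition standard_int :: "('f fsym \<Rightarrow> nat \<Rightarrow> bits list \<Rightarrow> bits) \<Rightarrow> bool" where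
  "standard_int I \<longleftrightarrow> (\<forall>\<eta>.
     I TrueF \<eta> [] = [True] \<and> I FalseF \<eta> [] = [False] \<and> I ZeroF \<eta> [] = replicate \<eta> False \<and>
     (\<forall>x y. I EqF \<eta> [x, y] = [x = y]) \<and>
     (\<forall>x y. I IteF \<eta> [[True], x, y] = x \<and> I IteF \<eta> [[False], x, y] = y) \<and>
     (\<forall>x y. length x = \<eta> \<longrightarrow> length y = \<eta> \<longrightarrow> I XorF \<eta> [x, y] = map2 (\<noteq>) x y))"

definition computational_model :: "('f, 'g) signature \<Rightarrow> ('n, 'f, 'g) model \<Rightarrow> bool" where
  "computational_model S M \<longleftrightarrow>
     (\<forall>\<eta> m n. m \<noteq> n \<longrightarrow> set (name_block M \<eta> m) \<inter> set (name_block M \<eta> n) = {}) \<and>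
     standard_int (fun_int M) \<and>
     (\<forall>f ss s. f \<notin> {TrueF, FalseF, ZeroF, EqF, IteF, XorF} \<longrightarrow> (ss, s) \<in> fsym_profiles S f \<longrightarrow>
        poly_time (args_dom ss) (fun_int M f) \<and>
        (\<forall>\<eta>. \<forall>xs \<in> args_dom ss \<eta>. fun_int M f \<eta> xs \<in> sort_dom \<eta> s)) \<and>
     (\<forall>g ss s. att_profile S g = (ss, s) \<longrightarrow>
        poly_time_tape (args_dom ss) (att_int M g) \<and>
        (\<forall>\<eta> \<rho>. \<forall>xs \<in> args_dom ss \<eta>. att_int M g \<eta> xs \<rho> \<in> sort_dom \<eta> s))"

primrec eval :: "('n, 'f, 'g) model \<Rightarrow> nat \<Rightarrow> tape \<Rightarrow> tape \<Rightarrow> ('n, 'f, 'g) trm \<Rightarrow> bits" where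
  "eval M \<eta> \<rho>1 \<rho>2 (Name n) = map \<rho>1 (name_block M \<eta> n)"
| "eval M \<eta> \<rho>1 \<rho>2 (Fun f ts) = fun_int M f \<eta> (map (eval M \<eta> \<rho>1 \<rho>2) ts)"
| "eval M \<eta> \<rho>1 \<rho>2 (Att g ts) = att_int M g \<eta> (map (eval M \<eta> \<rho>1 \<rho>2) ts) \<rho>2"

definition negligible :: "(nat \<Rightarrow> real) \<Rightarrow> bool" where
  "negligible \<epsilon> \<longleftrightarrow> (\<forall>c. eventually (\<lambda>\<eta>. \<bar>\<epsilon> \<eta>\<bar> < 1 / real \<eta> ^ c) sequentially)"

definition coin_tape :: "tape measure" where
  "coin_tape = PiM UNIV (\<lambda>_. measure_pmf (pmf_of_set UNIV))"

definition accept_prob ::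
  "('n, 'f, 'g) model \<Rightarrow> (nat \<Rightarrow> bits list \<Rightarrow> tape \<Rightarrow> bits) \<Rightarrow> ('n, 'f, 'g) trm list \<Rightarrow> nat \<Rightarrow> real" where
  "accept_prob M A us \<eta> = measure (coin_tape \<Otimes>\<^sub>M coin_tape)
     {(\<rho>1, \<rho>2). A \<eta> (map (eval M \<eta> \<rho>1 \<rho>2) us) \<rho>2 = [True]}"

definition indist :: "('n, 'f, 'g) model \<Rightarrow> ('n, 'f, 'g) trm list \<Rightarrow> ('n, 'f, 'g) trm list \<Rightarrow> bool" where
  "indist M us vs \<longleftrightarrow> length us = length vs \<and>
     (\<forall>A. poly_time_tape (\<lambda>\<eta>. {xs. length xs = length us}) A \<longrightarrow>
        negligible (\<lambda>\<eta>. \<bar>accept_prob M A us \<eta> - accept_prob M A vs \<eta>\<bar>))"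

text \<open>The pair output by the adversary consists of the final contents of stacks 0 and 1.\<close>

definition cr_hk :: "(nat \<Rightarrow> bits \<Rightarrow> bits \<Rightarrow> bits) \<Rightarrow> bool" where
  "cr_hk h \<longleftrightarrow> (\<forall>P (p :: nat poly).
     (\<forall>\<eta> k \<rho>. length k = \<eta> \<longrightarrow> (\<exists>st. halts_with (\<lambda>m. h \<eta> m k) \<rho> P \<eta> [] (poly p \<eta>) st)) \<longrightarrow>
     negligible (\<lambda>\<eta>. measure (measure_pmf (pmf_of_set {k. length k = \<eta>}) \<Otimes>\<^sub>M coin_tape)
       {(k, \<rho>). \<exists>st. halts_with (\<lambda>m. h \<eta> m k) \<rho> P \<eta> [] (poly p \<eta>) st \<and>
                  st 0 \<noteq> st 1 \<and> h \<eta> (st 0) k = h \<eta> (st 1) k}))"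

definition model_hash :: "('n, 'f, 'g) model \<Rightarrow> nat \<Rightarrow> bits \<Rightarrow> bits \<Rightarrow> bits" where
  "model_hash M \<eta> m k = fun_int M HashF \<eta> [m, k]"

end

(* An adversary distinguishes the two sides only if the values of t and t' form a collision of the
   keyed hash function. Since the key occurs only as a hash key, a machine with oracle access to the
   hash function can compute both values: it draws the other names and the tape of the attacker
   symbols from disjoint residue classes of its own random tape, runs the programs of the function
   symbols on disjoint sets of stacks, and asks the oracle for the hashes under the key. Its view is
   distributed as in the model, hence collision resistance bounds the distinguishing probability. *)

theory Submission
  imports Defs
begin


section \<open>Composing programs\<close>

text \<open>Collision resistance speaks of concrete programs with step bounds, so the adversary must
  be exhibited as one instruction list and running times must be tracked through every composition.
  Three obstacles shape it. Addresses are absolute and stack numbers fixed, so every program of the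
  model has to be moved to other addresses and other stacks. There is one random tape, yet a name
  occurring twice must yield the same bits, and all attacker symbols must read the same tape from
  its start; since a machine can rewind, a residue class of positions serves as such a shared tape,
  with a modulus obtained from the finitely many names of \<open>t\<close> and \<open>t'\<close>.
  Finally, a value may become the input of another program, so lengths must stay polynomial along
  with the time. On the probabilistic side, \<open>measure\<close> gives 0 on non-measurable sets,
  so all events must be shown measurable; for machines this follows from the time bounds, since a
  run of T steps sees only the first T bits of the tape.\<close>

fun relocate :: "nat \<Rightarrow> instr \<Rightarrow> instr" where
  "relocate b (Branch i l0 l1 l2) = Branch i (b + l0) (b + l1) (b + l2)"
| "relocate b x = x"

lemma relocate_0 [simp]: "relocate 0 x = x"
  by (cases x) auto

lemma relocate_relocate [simp]: "relocate a (relocate b x) = relocate (a + b) x"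
  by (cases x) auto

text \<open>Branch targets are absolute, so a fragment written for address 0 occurs in a host
  program only in relocated form.\<close>

definition code_at :: "instr list \<Rightarrow> nat \<Rightarrow> instr list \<Rightarrow> bool" where
  "code_at P b C \<longleftrightarrow> b + length C \<le> length P \<and> (\<forall>i<length C. P ! (b + i) = relocate b (C ! i))"

lemma code_at_self: "code_at C 0 C"
  by (simp add: code_at_def)

lemma code_at_append1: "code_at P b (C @ D) \<Longrightarrow> code_at P b C"
  by (auto simp: code_at_def nth_append)

lemma code_at_append2:
  assumes "code_at P b (C @ map (relocate d) D)" "length C = d"
  shows "code_at P (b + d) D"
proof -
  have "P ! (b + d + i) = relocate (b + d) (D ! i)" if "i < length D" for i
    using assms that
    by (auto simp: code_at_def nth_append add.assoc dest: spec[of _ "d + i"])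
  then show ?thesis
    using assms by (auto simp: code_at_def)
qed

definition seq :: "instr list \<Rightarrow> instr list \<Rightarrow> instr list" (infixr ";;" 64) where
  "C ;; D = C @ map (relocate (length C)) D"

lemma length_seq [simp]: "length (C ;; D) = length C + length D"
  by (simp add: seq_def)

text \<open>Host program and base address are quantified universally, so a statement about a
  fragment can be used in any context. The time is only an upper bound, which lets estimates be
  rounded up; control leaves just behind the fragment.\<close>

definition runs :: "(bits \<Rightarrow> bits) \<Rightarrow> tape \<Rightarrow> instr list \<Rightarrow> nat \<Rightarrow>
    nat \<Rightarrow> (nat \<Rightarrow> bits) \<Rightarrow> nat \<Rightarrow> (nat \<Rightarrow> bits) \<Rightarrow> bool" where
  "runs orc \<rho> C T h s h' s' \<longleftrightarrow> (\<forall>P b. code_at P b C \<longrightarrow>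
     (\<exists>n\<le>T. (step orc \<rho> P ^^ n) \<lparr>pc = b, head = h, stack = s\<rparr> =
        \<lparr>pc = b + length C, head = h', stack = s'\<rparr>))"

lemma runs_mono: "runs orc \<rho> C T h s h' s' \<Longrightarrow> T \<le> U \<Longrightarrow> runs orc \<rho> C U h s h' s'"
  unfolding runs_def by (meson le_trans)

lemma funpow_add_apply: "(f ^^ n) x = y \<Longrightarrow> (f ^^ m) y = z \<Longrightarrow> (f ^^ (n + m)) x = z"
  by (metis add.commute comp_apply funpow_add)

lemma runs_seq:
  assumes "runs orc \<rho> C T h s h1 s1" "runs orc \<rho> D U h1 s1 h' s'"
  shows "runs orc \<rho> (C ;; D) (T + U) h s h' s'"
  unfolding runs_def
proof (intro allI impI)
  fix P b assume c: "code_at P b (C ;; D)"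
  then have c1: "code_at P b C" and c2: "code_at P (b + length C) D"
    by (auto simp: seq_def intro: code_at_append1 code_at_append2)
  obtain n where n: "n \<le> T" "(step orc \<rho> P ^^ n) \<lparr>pc = b, head = h, stack = s\<rparr> =
      \<lparr>pc = b + length C, head = h1, stack = s1\<rparr>"
    using assms(1) c1 unfolding runs_def by blast
  obtain m where m: "m \<le> U" "(step orc \<rho> P ^^ m) \<lparr>pc = b + length C, head = h1, stack = s1\<rparr> =
      \<lparr>pc = b + length C + length D, head = h', stack = s'\<rparr>"
    using assms(2) c2 unfolding runs_def by blast
  show "\<exists>n\<le>T + U. (step orc \<rho> P ^^ n) \<lparr>pc = b, head = h, stack = s\<rparr> =
      \<lparr>pc = b + length (C ;; D), head = h', stack = s'\<rparr>"
    using funpow_add_apply[OF n(2) m(2)] n(1) m(1)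
    by (intro exI[of _ "n + m"]) (auto simp: add.assoc)
qed

section \<open>Branch-free code\<close>

fun is_branch :: "instr \<Rightarrow> bool" where
  "is_branch (Branch i a b c) = True"
| "is_branch _ = False"

definition straight :: "instr list \<Rightarrow> bool" where
  "straight C \<longleftrightarrow> (\<forall>x\<in>set C. \<not> is_branch x)"

lemma straight_simps [simp]:
  "straight []" "straight (x # C) \<longleftrightarrow> \<not> is_branch x \<and> straight C"
  "straight (C @ D) \<longleftrightarrow> straight C \<and> straight D"
  by (auto simp: straight_def)

lemma relocate_no_branch [simp]: "\<not> is_branch x \<Longrightarrow> relocate b x = x"
  by (cases x) auto

lemma relocate_straight [simp]: "straight C \<Longrightarrow> map (relocate b) C = C"
  by (induction C) auto

lemma pc_exec_no_branch: "\<not> is_branch x \<Longrightarrow> pc (exec_instr orc \<rho> x c) = Suc (pc c)"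
  by (cases x) auto

lemma exec_no_branch_pc:
  "\<not> is_branch x \<Longrightarrow>
   exec_instr orc \<rho> x (c\<lparr>pc := p\<rparr>) = (exec_instr orc \<rho> x c)\<lparr>pc := Suc p\<rparr>"
  by (cases x) auto

lemma fold_straight_pc:
  "straight C \<Longrightarrow> fold (exec_instr orc \<rho>) C (c\<lparr>pc := p\<rparr>) =
     (fold (exec_instr orc \<rho>) C c)\<lparr>pc := p + length C\<rparr>"
proof (induction C arbitrary: c p)
  case Nil
  then show ?case by simp
next
  case (Cons x C)
  then show ?case by (simp add: exec_no_branch_pc)
qed

text \<open>Without branches, relocation changes nothing and instructions are executed in textual
  order, so a run is a fold that the simplifier can compute.\<close>

lemma steps_straight:
  "straight C \<Longrightarrow> code_at P (pc c) C \<Longrightarrow>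
   (step orc \<rho> P ^^ length C) c = fold (exec_instr orc \<rho>) C c"
proof (induction C arbitrary: c)
  case Nil
  then show ?case by simp
next
  case (Cons x C)
  have a: "P ! pc c = x" "pc c < length P"
    using Cons.prems by (auto simp: code_at_def)
  then have st: "step orc \<rho> P c = exec_instr orc \<rho> x c"
    by (simp add: step_def)
  have "code_at P (pc c) ([x] @ map (relocate 1) C)"
    using Cons.prems by simp
  then have "code_at P (pc c + 1) C"
    by (rule code_at_append2) simp
  then have "code_at P (pc (exec_instr orc \<rho> x c)) C"
    using Cons.prems by (simp add: pc_exec_no_branch)
  then show ?case
    using Cons by (simp add: funpow_swap1 st)
qed

lemma runs_straight:
  assumes "straight C" "fold (exec_instr orc \<rho>) C \<lparr>pc = 0, head = h, stack = s\<rparr> = c"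
    "head c = h'" "stack c = s'"
  shows "runs orc \<rho> C (length C) h s h' s'"
  unfolding runs_def
proof (intro allI impI exI conjI)
  fix P b assume c: "code_at P b C"
  have "(step orc \<rho> P ^^ length C) \<lparr>pc = b, head = h, stack = s\<rparr> =
        fold (exec_instr orc \<rho>) C (\<lparr>pc = 0, head = h, stack = s\<rparr>\<lparr>pc := b\<rparr>)"
    using c assms(1) by (subst steps_straight) auto
  also have "\<dots> = c\<lparr>pc := b + length C\<rparr>"
    using assms(1,2) by (simp only: fold_straight_pc)
  finally show "(step orc \<rho> P ^^ length C) \<lparr>pc = b, head = h, stack = s\<rparr> =
      \<lparr>pc = b + length C, head = h', stack = s'\<rparr>"
    using assms(3,4) by (cases c) auto
qed simp

text \<open>A \<open>Branch\<close> with three equal targets is an unconditional jump: the last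
  instruction returns to the test, whose first target is the address just behind that jump.\<close>

definition loop :: "nat \<Rightarrow> instr list \<Rightarrow> instr list" where
  "loop i C = Branch i (Suc (Suc (length C))) 1 1 # map (relocate 1) C @ [Branch 0 0 0 0]"

lemma length_loop [simp]: "length (loop i C) = length C + 2"
  by (simp add: loop_def)

lemma step_Branch:
  assumes "P ! p = Branch i x y z" "p < length P"
  shows "step orc \<rho> P \<lparr>pc = p, head = h, stack = s\<rparr> =
    \<lparr>pc = (case s i of [] \<Rightarrow> x | b # _ \<Rightarrow> if b then z else y), head = h, stack = s\<rparr>"
  using assms by (simp add: step_def)

lemma runs_loop_empty:
  assumes "s i = []"
  shows "runs orc \<rho> (loop i C) 1 h s h s"
  unfolding runs_def
proof (intro allI impI exI conjI)
  fix P b assume c: "code_at P b (loop i C)"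
  then have "P ! b = Branch i (b + Suc (Suc (length C))) (b + 1) (b + 1)" "b < length P"
    by (auto simp: code_at_def loop_def dest: spec[of _ 0])
  then show "(step orc \<rho> P ^^ 1) \<lparr>pc = b, head = h, stack = s\<rparr> =
      \<lparr>pc = b + length (loop i C), head = h, stack = s\<rparr>"
    using assms by (simp add: step_Branch)
qed simp

text \<open>The two extra steps are the test and the jump back.\<close>

lemma runs_loop_step:
  assumes "s i \<noteq> []" "runs orc \<rho> C T h s h1 s1" "runs orc \<rho> (loop i C) U h1 s1 h' s'"
  shows "runs orc \<rho> (loop i C) (T + U + 2) h s h' s'"
  unfolding runs_def
proof (intro allI impI)
  fix P b assume c: "code_at P b (loop i C)"
  then have B: "P ! b = Branch i (b + Suc (Suc (length C))) (b + 1) (b + 1)" "b < length P"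
    by (auto simp: code_at_def loop_def dest: spec[of _ 0])
  have J: "P ! (b + Suc (length C)) = Branch 0 b b b" "b + Suc (length C) < length P"
    using c by (auto simp: code_at_def loop_def nth_append dest: spec[of _ "Suc (length C)"])
  have "code_at P b (([Branch i (Suc (Suc (length C))) 1 1] @ map (relocate 1) C) @ [Branch 0 0 0 0])"
    using c by (simp add: loop_def)
  then have "code_at P b ([Branch i (Suc (Suc (length C))) 1 1] @ map (relocate 1) C)"
    by (rule code_at_append1)
  then have cC: "code_at P (b + 1) C"
    by (rule code_at_append2) simp
  obtain n where n: "n \<le> T" "(step orc \<rho> P ^^ n) \<lparr>pc = b + 1, head = h, stack = s\<rparr> =
      \<lparr>pc = b + 1 + length C, head = h1, stack = s1\<rparr>"
    using assms(2) cC unfolding runs_def by blast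
  obtain m where m: "m \<le> U" "(step orc \<rho> P ^^ m) \<lparr>pc = b, head = h1, stack = s1\<rparr> =
      \<lparr>pc = b + length (loop i C), head = h', stack = s'\<rparr>"
    using assms(3) c unfolding runs_def by blast
  have 1: "(step orc \<rho> P ^^ 1) \<lparr>pc = b, head = h, stack = s\<rparr> =
      \<lparr>pc = b + 1, head = h, stack = s\<rparr>"
    using assms(1) by (simp add: step_Branch[OF B] split: list.splits)
  have 2: "(step orc \<rho> P ^^ 1) \<lparr>pc = b + 1 + length C, head = h1, stack = s1\<rparr> =
      \<lparr>pc = b, head = h1, stack = s1\<rparr>"
    using step_Branch[OF J, of orc \<rho> h1 s1] by (simp split: list.splits)
  note r = funpow_add_apply[OF 1 funpow_add_apply[OF n(2) funpow_add_apply[OF 2 m(2)]]]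
  show "\<exists>n\<le>T + U + 2. (step orc \<rho> P ^^ n) \<lparr>pc = b, head = h, stack = s\<rparr> =
      \<lparr>pc = b + length (loop i C), head = h', stack = s'\<rparr>"
    using r n(1) m(1) by (intro exI[of _ "1 + (n + (1 + m))"]) auto
qed

text \<open>The arms start at 1, \<open>a\<close> and \<open>b\<close>, and each ends with a jump to
  the common exit \<open>e\<close>. The 2 in \<open>a\<close> counts the test and the jump that
  closes \<open>A\<close>.\<close>

definition branch :: "nat \<Rightarrow> instr list \<Rightarrow> instr list \<Rightarrow> instr list \<Rightarrow> instr list" where
  "branch i A B D =
     (let a = length A + 2; b = a + length B + 1; e = b + length D + 1 in
       Branch i 1 a b # map (relocate 1) A @ Branch 0 e e e #
       map (relocate a) B @ Branch 0 e e e # map (relocate b) D @ [Branch 0 e e e])"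

lemma length_branch [simp]: "length (branch i A B D) = length A + length B + length D + 4"
  by (simp add: branch_def Let_def)

lemma code_at_instr:
  assumes "code_at P b (X @ x # Y)" "length X = d"
  shows "P ! (b + d) = relocate b x" "b + d < length P"
  using assms by (auto simp: code_at_def dest!: spec[of _ d])

text \<open>Treats the three arms at once: \<open>X\<close> is the code between the test and the
  chosen arm \<open>C\<close>. The two extra steps are the test and the jump to the exit.\<close>

lemma runs_branch_aux:
  assumes F: "F = Branch i x y z # X @ map (relocate (Suc (length X))) C @ Branch 0 e e e # Y"
    and e: "e = length F"
    and t: "(case s i of [] \<Rightarrow> x | b # _ \<Rightarrow> if b then z else y) = Suc (length X)"
    and r: "runs orc \<rho> C T h s h' s'"
  shows "runs orc \<rho> F (T + 2) h s h' s'"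
  unfolding runs_def
proof (intro allI impI)
  fix P b assume c: "code_at P b F"
  have c': "code_at P b (([Branch i x y z] @ X) @ map (relocate (Suc (length X))) C @ Branch 0 e e e # Y)"
    using c by (simp add: F)
  have cC: "code_at P (b + Suc (length X)) C"
    using code_at_append1[of P b "([Branch i x y z] @ X) @ map (relocate (Suc (length X))) C"] c'
    by (intro code_at_append2[of P b "[Branch i x y z] @ X"]) auto
  have B: "P ! b = relocate b (Branch i x y z)" "b < length P"
    using code_at_instr[of P b "[]"] c by (simp_all add: F)
  have J: "P ! (b + Suc (length X) + length C) = relocate b (Branch 0 e e e)"
     "b + Suc (length X) + length C < length P"
    using code_at_instr[of P b "([Branch i x y z] @ X) @ map (relocate (Suc (length X))) C" "Branch 0 e e e" Y,
        OF _ refl] c' by (simp_all add: add.assoc)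
  obtain n where n: "n \<le> T" "(step orc \<rho> P ^^ n) \<lparr>pc = b + Suc (length X), head = h, stack = s\<rparr> =
      \<lparr>pc = b + Suc (length X) + length C, head = h', stack = s'\<rparr>"
    using r cC unfolding runs_def by blast
  have 1: "(step orc \<rho> P ^^ 1) \<lparr>pc = b, head = h, stack = s\<rparr> =
      \<lparr>pc = b + Suc (length X), head = h, stack = s\<rparr>"
    using t B by (cases "s i") (auto simp: step_Branch)
  have 2: "(step orc \<rho> P ^^ 1) \<lparr>pc = b + Suc (length X) + length C, head = h', stack = s'\<rparr> =
      \<lparr>pc = b + length F, head = h', stack = s'\<rparr>"
    using step_Branch[OF J(1)[simplified relocate.simps] J(2), of orc \<rho> h' s']
    by (simp add: e split: list.splits)
  show "\<exists>n\<le>T + 2. (step orc \<rho> P ^^ n) \<lparr>pc = b, head = h, stack = s\<rparr> =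
      \<lparr>pc = b + length F, head = h', stack = s'\<rparr>"
    using funpow_add_apply[OF 1 funpow_add_apply[OF n(2) 2]] n(1)
    by (intro exI[of _ "1 + (n + 1)"]) auto
qed

lemma runs_branch_empty:
  assumes "s i = []" "runs orc \<rho> A T h s h' s'"
  shows "runs orc \<rho> (branch i A B D) (T + 2) h s h' s'"
  by (rule runs_branch_aux[where X = "[]", OF _ _ _ assms(2)])
    (auto simp: branch_def Let_def assms(1))

lemma runs_branch_False:
  assumes "s i = False # w" "runs orc \<rho> B T h s h' s'"
  shows "runs orc \<rho> (branch i A B D) (T + 2) h s h' s'"
  by (rule runs_branch_aux[where X = "map (relocate 1) A @ [Branch 0 e e e]" for e, OF _ _ _ assms(2)])
    (auto simp: branch_def Let_def assms(1))

lemma runs_branch_True: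
  assumes "s i = True # w" "runs orc \<rho> D T h s h' s'"
  shows "runs orc \<rho> (branch i A B D) (T + 2) h s h' s'"
  by (rule runs_branch_aux[where
        X = "map (relocate 1) A @ Branch 0 e e e # map (relocate a) B @ [Branch 0 e e e]" for a e,
        OF _ _ _ assms(2)])
    (auto simp: branch_def Let_def assms(1))


text \<open>A configuration outside the program is a fixed point of \<open>step\<close>, so the
  exact step count in \<open>halts_with\<close> may be any number above the actual running
  time.\<close>

lemma runs_halts_with:
  assumes "runs orc \<rho> P T 0 (stack (init \<eta> xs)) h' s'" "T \<le> U"
  shows "halts_with orc \<rho> P \<eta> xs U s'"
proof -
  obtain n where n: "n \<le> T"
    "(step orc \<rho> P ^^ n) \<lparr>pc = 0, head = 0, stack = stack (init \<eta> xs)\<rparr> =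
     \<lparr>pc = length P, head = h', stack = s'\<rparr>"
    using assms(1) code_at_self[of P] unfolding runs_def by fastforce
  have i: "\<lparr>pc = 0, head = 0, stack = stack (init \<eta> xs)\<rparr> = init \<eta> xs"
    by (simp add: init_def)
  have "(step orc \<rho> P ^^ m) \<lparr>pc = length P, head = h', stack = s'\<rparr> =
      \<lparr>pc = length P, head = h', stack = s'\<rparr>" for m
    by (induction m) (auto simp: step_def)
  from funpow_add_apply[OF n(2) this[of "U - n"]] n(1) assms(2) show ?thesis
    by (simp add: halts_with_def i)
qed

lemma poly_timeI:
  assumes "oracle_free P" "coin_free P"
    and "\<And>\<eta> xs. xs \<in> D \<eta> \<Longrightarrow> \<exists>T h' s'. T \<le> poly p (input_size \<eta> xs) \<and> s' 0 = f \<eta> xs \<and>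
        runs (\<lambda>_. []) (\<lambda>_. False) P T 0 (stack (init \<eta> xs)) h' s'"
  shows "poly_time D f"
  unfolding poly_time_def using assms by (meson runs_halts_with)

lemma ex_runsI:
  "runs orc \<rho> P T 0 s h' s' \<Longrightarrow> T \<le> U \<Longrightarrow> s' 0 = y \<Longrightarrow>
   \<exists>T h' s'. T \<le> U \<and> s' 0 = y \<and> runs orc \<rho> P T 0 s h' s'"
  by blast

lemma free_append [simp]:
  "oracle_free (C @ D) \<longleftrightarrow> oracle_free C \<and> oracle_free D"
  "coin_free (C @ D) \<longleftrightarrow> coin_free C \<and> coin_free D"
  by (auto simp: oracle_free_def coin_free_def)

lemma free_simps [simp]:
  "oracle_free []" "coin_free []"
  "oracle_free (x # C) \<longleftrightarrow> (\<forall>i j. x \<noteq> Query i j) \<and> oracle_free C"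
  "coin_free (x # C) \<longleftrightarrow> (\<forall>i. x \<noteq> Coin i) \<and> coin_free C"
  by (auto simp: oracle_free_def coin_free_def)

lemma relocate_eq_iff [simp]:
  "relocate b x = Query i j \<longleftrightarrow> x = Query i j" "relocate b x = Coin i \<longleftrightarrow> x = Coin i"
  by (cases x; auto)+

lemma free_map_relocate [simp]:
  "oracle_free (map (relocate b) C) \<longleftrightarrow> oracle_free C"
  "coin_free (map (relocate b) C) \<longleftrightarrow> coin_free C"
  by (induction C) auto

lemma free_constructs [simp]:
  "oracle_free (C ;; D) \<longleftrightarrow> oracle_free C \<and> oracle_free D"
  "coin_free (C ;; D) \<longleftrightarrow> coin_free C \<and> coin_free D"
  "oracle_free (loop i C) \<longleftrightarrow> oracle_free C"
  "coin_free (loop i C) \<longleftrightarrow> coin_free C"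
  "oracle_free (branch i A B D) \<longleftrightarrow> oracle_free A \<and> oracle_free B \<and> oracle_free D"
  "coin_free (branch i A B D) \<longleftrightarrow> coin_free A \<and> coin_free B \<and> coin_free D"
  by (auto simp: seq_def loop_def branch_def Let_def)

section \<open>Elementary operations on stacks\<close>

definition move :: "nat \<Rightarrow> nat \<Rightarrow> bool \<Rightarrow> instr list" where
  "move i j b = loop i [Pop i, Push j b]"

lemma move_free [simp]: "oracle_free (move i j b)" "coin_free (move i j b)"
  by (auto simp: move_def)

text \<open>Each bit costs a test, a pop, a push and the jump back; the last test accounts for the
  1.\<close>

lemma runs_move:
  assumes "i \<noteq> j"
  shows "runs orc \<rho> (move i j b) (4 * length (s i) + 1) h s h
           (s(i := [], j := replicate (length (s i)) b @ s j))"
proof (induction "s i" arbitrary: s)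
  case Nil
  then show ?case
    using assms runs_loop_empty[of s i orc \<rho> _ h] by (simp add: move_def fun_upd_idem)
next
  case (Cons x w)
  define s1 where "s1 = s(i := w, j := b # s j)"
  have 1: "runs orc \<rho> [Pop i, Push j b] 2 h s h s1"
    using Cons.hyps(2)[symmetric] assms
    by (intro runs_mono[OF runs_straight]) (auto simp: s1_def)
  have "w = s1 i" using assms by (simp add: s1_def)
  from Cons.hyps(1)[of s1, OF this]
  have 2: "runs orc \<rho> (move i j b) (4 * length w + 1) h s1 h
      (s1(i := [], j := replicate (length w) b @ s1 j))"
    using assms by (simp add: s1_def)
  have "runs orc \<rho> (move i j b) (2 + (4 * length w + 1) + 2) h s h
      (s1(i := [], j := replicate (length w) b @ s1 j))"
    using runs_loop_step[OF _ 1 2[unfolded move_def]] Cons.hyps(2)[symmetric]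
    by (simp add: move_def)
  moreover have "s1(i := [], j := replicate (length w) b @ s1 j) =
      s(i := [], j := replicate (length (s i)) b @ s j)"
    using assms Cons.hyps(2)[symmetric]
    by (auto simp: s1_def replicate_app_Cons_same fun_eq_iff)
  ultimately show ?case
    using Cons.hyps(2)[symmetric] by (auto elim: runs_mono)
qed

definition clear :: "nat \<Rightarrow> instr list" where
  "clear i = loop i [Pop i]"

lemma clear_free [simp]: "oracle_free (clear i)" "coin_free (clear i)"
  by (auto simp: clear_def)

lemma runs_clear:
  "runs orc \<rho> (clear i) (3 * length (s i) + 1) h s h (s(i := []))"
proof (induction "s i" arbitrary: s)
  case Nil
  then show ?case
    using runs_loop_empty[of s i orc \<rho> _ h] by (simp add: clear_def fun_upd_idem)
next
  case (Cons x w)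
  have 1: "runs orc \<rho> [Pop i] 1 h s h (s(i := w))"
    using Cons.hyps(2)[symmetric] by (intro runs_mono[OF runs_straight]) auto
  have 2: "runs orc \<rho> (clear i) (3 * length w + 1) h (s(i := w)) h (s(i := []))"
    using Cons.hyps(1)[of "s(i := w)"] by simp
  have "runs orc \<rho> (clear i) (1 + (3 * length w + 1) + 2) h s h (s(i := []))"
    using runs_loop_step[OF _ 1 2[unfolded clear_def]] Cons.hyps(2)[symmetric]
    by (simp add: clear_def)
  then show ?case
    using Cons.hyps(2)[symmetric] by (auto elim: runs_mono)
qed

lemma runs_branch_bit:
  assumes "s i = x # w" "runs orc \<rho> (if x then D else B) T h s h' s'"
  shows "runs orc \<rho> (branch i A B D) (T + 2) h s h' s'"
  using assms runs_branch_True[of s i w] runs_branch_False[of s i w] by (cases x) auto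

text \<open>No instruction transfers a bit, so the top bit is branched on and pushed as a constant.
  The first arm belongs to an empty stack, which the test of the loop excludes.\<close>

definition reverse :: "nat \<Rightarrow> nat \<Rightarrow> instr list" where
  "reverse i j = loop i (branch i [] [Pop i, Push j False] [Pop i, Push j True])"

lemma reverse_free [simp]: "oracle_free (reverse i j)" "coin_free (reverse i j)"
  by (auto simp: reverse_def)

lemma runs_reverse:
  assumes "i \<noteq> j"
  shows "runs orc \<rho> (reverse i j) (6 * length (s i) + 1) h s h
           (s(i := [], j := rev (s i) @ s j))"
proof (induction "s i" arbitrary: s)
  case Nil
  then show ?case
    using assms runs_loop_empty[of s i orc \<rho> _ h] by (simp add: reverse_def fun_upd_idem)
next
  case (Cons x w)
  define s1 where "s1 = s(i := w, j := x # s j)"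
  have "runs orc \<rho> [Pop i, Push j x] 2 h s h s1"
    using Cons.hyps(2)[symmetric] assms
    by (intro runs_mono[OF runs_straight]) (auto simp: s1_def)
  then have 1: "runs orc \<rho> (branch i [] [Pop i, Push j False] [Pop i, Push j True]) (2 + 2) h s h s1"
    by (intro runs_branch_bit[of s i, OF Cons.hyps(2)[symmetric]]) (cases x; simp)
  have "w = s1 i" using assms by (simp add: s1_def)
  from Cons.hyps(1)[of s1, OF this]
  have 2: "runs orc \<rho> (reverse i j) (6 * length w + 1) h s1 h
      (s1(i := [], j := rev w @ s1 j))"
    using assms by (simp add: s1_def)
  have "runs orc \<rho> (reverse i j) (2 + 2 + (6 * length w + 1) + 2) h s h
      (s1(i := [], j := rev w @ s1 j))"
    using runs_loop_step[OF _ 1 2[unfolded reverse_def]] Cons.hyps(2)[symmetric]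
    by (simp add: reverse_def)
  moreover have "s1(i := [], j := rev w @ s1 j) = s(i := [], j := rev (s i) @ s j)"
    using assms Cons.hyps(2)[symmetric] by (auto simp: s1_def fun_eq_iff)
  ultimately show ?case
    using Cons.hyps(2)[symmetric] by (auto elim: runs_mono)
qed

lemma stack_init: "stack (init \<eta> xs) i = (if i \<le> length xs then (replicate \<eta> True # xs) ! i else [])"
  by (simp add: init_def)

section \<open>The standard symbols run in polynomial time\<close>

text \<open>For the symbols of fixed meaning a model specifies only the function, so machines for
  them have to be written. Linear time suffices; the factors 3, 8 and 20 below are rounded-up step
  counts.\<close>

definition lin_poly :: "nat \<Rightarrow> nat poly" where
  "lin_poly c = [:c, c:]"

lemma poly_lin [simp]: "poly (lin_poly c) n = c + c * n"
  by (simp add: lin_poly_def algebra_simps)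

lemma poly_time_const:
  assumes "\<And>\<eta>. f \<eta> [] = [b]"
  shows "poly_time (args_dom []) f"
proof (rule poly_timeI[where P = "clear 0 ;; [Push 0 b]" and p = "lin_poly 3"])
  fix \<eta> xs assume "xs \<in> args_dom [] \<eta>"
  then have xs: "xs = []" by (simp add: args_dom_def)
  define s where "s = stack (init \<eta> xs)"
  have s0: "s 0 = replicate \<eta> True" by (simp add: s_def stack_init)
  have "runs (\<lambda>_. []) (\<lambda>_. False) [Push 0 b] 1 0 (s(0 := [])) 0 (s(0 := [b]))"
    by (intro runs_mono[OF runs_straight]) auto
  from runs_seq[OF runs_clear[of _ _ 0 s] this]
  show "\<exists>T h' s'. T \<le> poly (lin_poly 3) (input_size \<eta> xs) \<and> s' 0 = f \<eta> xs \<and>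
     runs (\<lambda>_. []) (\<lambda>_. False) (clear 0 ;; [Push 0 b]) T 0 (stack (init \<eta> xs)) h' s'"
    unfolding s_def[symmetric]
    by (rule ex_runsI) (auto simp: s0 input_size_def assms xs)
qed auto

text \<open>\<open>move\<close> needs two different stacks, hence the detour over stack 1; the unary
  input turns into zeros on the way.\<close>

lemma poly_time_zero:
  assumes "\<And>\<eta>. f \<eta> [] = replicate \<eta> False"
  shows "poly_time (args_dom []) f"
proof (rule poly_timeI[where P = "move 0 1 False ;; move 1 0 False" and p = "lin_poly 8"])
  fix \<eta> xs assume "xs \<in> args_dom [] \<eta>"
  then have xs: "xs = []" by (simp add: args_dom_def)
  define s where "s = stack (init \<eta> xs)"
  have s0: "s 0 = replicate \<eta> True" "s (Suc 0) = []" by (simp_all add: s_def stack_init xs)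
  from runs_seq[OF runs_move[of 0 1 "\<lambda>_. []" "\<lambda>_. False" False s 0] runs_move[of 1 0 "\<lambda>_. []" "\<lambda>_. False" False _ 0]]
  show "\<exists>T h' s'. T \<le> poly (lin_poly 8) (input_size \<eta> xs) \<and> s' 0 = f \<eta> xs \<and>
     runs (\<lambda>_. []) (\<lambda>_. False) (move 0 1 False ;; move 1 0 False) T 0 (stack (init \<eta> xs)) h' s'"
    unfolding s_def[symmetric]
    by (intro ex_runsI[of _ _ _ "4 * \<eta> + 1 + (4 * \<eta> + 1)" _ 0 "s(1 := [], 0 := replicate \<eta> False)"])
      (auto simp: s0 input_size_def assms xs fun_upd_twist)
qed auto

lemma args_domD:
  "xs \<in> args_dom [a, b] \<eta> \<Longrightarrow>
     \<exists>x y. xs = [x, y] \<and> x \<in> sort_dom \<eta> a \<and> y \<in> sort_dom \<eta> b"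
  "xs \<in> args_dom [a, b, c] \<eta> \<Longrightarrow>
     \<exists>x y z. xs = [x, y, z] \<and> x \<in> sort_dom \<eta> a \<and> y \<in> sort_dom \<eta> b \<and> z \<in> sort_dom \<eta> c"
  by (auto simp: args_dom_def list_all2_Cons2)

text \<open>The selected argument reaches stack 0 by two reversals, through stack 4, which restore
  the order of its bits.\<close>

lemma poly_time_ite:
  assumes "\<And>\<eta> x y. f \<eta> [[True], x, y] = x" "\<And>\<eta> x y. f \<eta> [[False], x, y] = y"
  shows "poly_time (args_dom [BoolS, a, a]) f"
proof (rule poly_timeI[where P = "clear 0 ;; branch 1 [] (reverse 3 4) (reverse 2 4) ;; reverse 4 0"
      and p = "lin_poly 20"])
  fix \<eta> xs assume "xs \<in> args_dom [BoolS, a, a] \<eta>"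
  then obtain b x y where b: "xs = [b, x, y]" "b \<in> sort_dom \<eta> BoolS"
    using args_domD(2) by blast
  then obtain c where xs: "xs = [[c], x, y]"
    by auto
  define s where "s = stack (init \<eta> xs)"
  define s1 where "s1 = s(0 := [])"
  define z where "z = (if c then x else y)"
  define k where "k = (if c then 2 else 3 :: nat)"
  define s2 where "s2 = s1(k := [], 4 := rev z)"
  have s: "s 0 = replicate \<eta> True" "s1 1 = [c]" "s1 k = z" "s1 4 = []" "k \<noteq> 4"
    "s2 4 = rev z" "s2 0 = []"
    by (simp_all add: s_def s1_def s2_def k_def z_def stack_init xs)
  have z: "f \<eta> xs = z" "length z \<le> length x + length y"
    using assms by (cases c; simp add: z_def xs)+
  have 1: "runs (\<lambda>_. []) (\<lambda>_. False) (clear 0) (3 * \<eta> + 1) 0 s 0 s1"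
    using runs_clear[of _ _ 0 s 0] by (simp add: s s1_def)
  have "runs (\<lambda>_. []) (\<lambda>_. False) (reverse k 4) (6 * length z + 1) 0 s1 0 s2"
    using runs_reverse[of k 4 _ _ s1 0] s by (simp add: s2_def)
  then have 2: "runs (\<lambda>_. []) (\<lambda>_. False) (branch 1 [] (reverse 3 4) (reverse 2 4))
      (6 * length z + 1 + 2) 0 s1 0 s2"
    using s by (intro runs_branch_bit[of _ _ c "[]"]) (auto simp: k_def)
  have 3: "runs (\<lambda>_. []) (\<lambda>_. False) (reverse 4 0) (6 * length z + 1) 0 s2 0
      (s2(4 := [], 0 := z))"
    using runs_reverse[of 4 0 "\<lambda>_. []" "\<lambda>_. False" s2 0] s by simp
  show "\<exists>T h' s'. T \<le> poly (lin_poly 20) (input_size \<eta> xs) \<and> s' 0 = f \<eta> xs \<and>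
     runs (\<lambda>_. []) (\<lambda>_. False) (clear 0 ;; branch 1 [] (reverse 3 4) (reverse 2 4) ;; reverse 4 0)
       T 0 (stack (init \<eta> xs)) h' s'"
    unfolding s_def[symmetric]
    by (rule ex_runsI[OF runs_seq[OF 1 runs_seq[OF 2 3]]])
      (use z in \<open>auto simp: input_size_def xs\<close>)
qed auto

lemma runs_instrs:
  assumes "fold (exec_instr orc \<rho>) C \<lparr>pc = 0, head = h, stack = s\<rparr> = c"
    "straight C" "length C \<le> T" "head c = h'" "stack c = s'"
  shows "runs orc \<rho> C T h s h' s'"
  using runs_mono[OF runs_straight] assms by blast

text \<open>Stack 3 is a flag, raised at every mismatch; an exhausted stack 2 counts as one while
  stack 1 still has bits, and popping it then is harmless. Surplus bits of stack 2 are left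
  there.\<close>

definition compare :: "instr list" where
  "compare = loop 1 (branch 1 [] (branch 2 [Push 3 True] [] [Push 3 True])
     (branch 2 [Push 3 True] [Push 3 True] []) ;; [Pop 1, Pop 2])"

lemma compare_free [simp]: "oracle_free compare" "coin_free compare"
  by (auto simp: compare_def)

text \<open>The initial flag is arbitrary so that the induction also covers the rounds after a
  mismatch. Stack 2 enters the criterion because a longer second string leaves its surplus
  there.\<close>

lemma runs_compare:
  "\<exists>s'. runs orc \<rho> compare (9 * length (s 1) + 1) h s h s' \<and> s' 0 = s 0 \<and>
     (s' 2 = [] \<and> s' 3 = [] \<longleftrightarrow> s 1 = s 2 \<and> s 3 = [])"
proof (induction "s 1" arbitrary: s)
  case Nil
  then show ?case
    using runs_loop_empty[of s 1 orc \<rho> _ h] by (intro exI[of _ s]) (auto simp: compare_def)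
next
  \<comment> \<open>Keeps the stack number 1 from being rewritten to \<open>Suc 0\<close>, the form
    in which the other facts do not mention it.\<close>
  note One_nat_def [simp del]
  case (Cons x w)
  have x: "s 1 = x # w" using Cons.hyps(2) by simp
  let ?B = "branch 1 [] (branch 2 [Push 3 True] [] [Push 3 True])
     (branch 2 [Push 3 True] [Push 3 True] [])"
  define s1 where "s1 = (if s 2 \<noteq> [] \<and> hd (s 2) = x then s else s(3 := True # s 3))"
  define s2 where "s2 = s1(1 := w, 2 := tl (s 2))"
  have m: "runs orc \<rho> [] 1 h s h s" "runs orc \<rho> [Push 3 True] 1 h s h (s(3 := True # s 3))"
    by - (rule runs_instrs[OF refl]; simp)+
  have "runs orc \<rho> (if x then branch 2 [Push 3 True] [Push 3 True] []
      else branch 2 [Push 3 True] [] [Push 3 True]) (1 + 2) h s h s1"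
  proof (cases "s 2")
    case Nil
    show ?thesis
      using Nil m by (cases x; simp only: if_True if_False; intro runs_branch_empty)
        (auto simp: s1_def)
  next
    case (Cons y v)
    show ?thesis
      using Cons m by (cases x; simp only: if_True if_False; intro runs_branch_bit[of s 2, OF Cons])
        (auto simp: s1_def)
  qed
  then have 1: "runs orc \<rho> ?B (1 + 2 + 2) h s h s1"
    by (rule runs_branch_bit[of s 1, OF x])
  have 2: "runs orc \<rho> [Pop 1, Pop 2] 2 h s1 h s2"
    by (rule runs_instrs) (auto simp: s1_def s2_def x)
  obtain s' where s': "runs orc \<rho> compare (9 * length w + 1) h s2 h s'" "s' 0 = s2 0"
    "s' 2 = [] \<and> s' 3 = [] \<longleftrightarrow> s2 1 = s2 2 \<and> s2 3 = []"
    using Cons.hyps(1)[of s2] by (auto simp: s2_def)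
  have "runs orc \<rho> compare (1 + 2 + 2 + 2 + (9 * length w + 1) + 2) h s h s'"
    unfolding compare_def using x
    by (intro runs_loop_step[OF _ runs_seq[OF 1 2] s'(1)[unfolded compare_def]]) simp
  then show ?case
    using s'(2,3) by (intro exI[of _ s'])
      (cases "s 2", auto simp: x s2_def s1_def split: if_splits)
qed

lemma poly_time_eq:
  assumes "\<And>\<eta> x y. f \<eta> [x, y] = [x = y]"
  shows "poly_time (args_dom [a, b]) f"
proof (rule poly_timeI[where P = "compare ;; branch 2 [] [Push 3 True] [Push 3 True] ;; clear 0 ;;
        branch 3 [Push 0 True] [Push 0 False] [Push 0 False]"
      and p = "lin_poly 20"])
  note One_nat_def [simp del]
  let ?runs = "runs (\<lambda>_. []) (\<lambda>_. False)"
  fix \<eta> xs assume "xs \<in> args_dom [a, b] \<eta>"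
  then obtain x y where xs: "xs = [x, y]"
    by (auto dest!: args_domD)
  define s where "s = stack (init \<eta> xs)"
  have s: "s 0 = replicate \<eta> True" "s 1 = x" "s 2 = y" "s 3 = []"
    by (simp_all add: s_def stack_init xs)
  obtain s1 where 1: "?runs compare (9 * length x + 1) 0 s 0 s1"
    and s1: "s1 0 = s 0" "s1 2 = [] \<and> s1 3 = [] \<longleftrightarrow> x = y"
    using runs_compare[of _ _ s 0] s by auto
  \<comment> \<open>A surplus on stack 2 is turned into a raised flag, so that the final branch has
    to inspect stack 3 only.\<close>
  define s2 where "s2 = (if s1 2 = [] then s1 else s1(3 := True # s1 3))"
  have "?runs (branch 2 [] [Push 3 True] [Push 3 True]) (1 + 2) 0 s1 0 s2"
  proof (cases "s1 2")
    case Nil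
    then show ?thesis
      by (intro runs_branch_empty runs_instrs) (auto simp: s2_def)
  next
    case (Cons c w)
    then show ?thesis
      by (intro runs_branch_bit[of s1 2, OF Cons]; cases c; intro runs_instrs) (auto simp: s2_def)
  qed
  note 2 = this
  have "s2 0 = replicate \<eta> True" using s s1 by (simp add: s2_def)
  then have 3: "?runs (clear 0) (3 * \<eta> + 1) 0 s2 0 (s2(0 := []))"
    using runs_clear[of "\<lambda>_. []" "\<lambda>_. False" 0 s2 0] by simp
  have "?runs (branch 3 [Push 0 True] [Push 0 False] [Push 0 False]) (1 + 2) 0
      (s2(0 := [])) 0 (s2(0 := [x = y]))"
  proof (cases "s2 3")
    case Nil
    then have "x = y" using s1 by (auto simp: s2_def split: if_splits)
    then show ?thesis using Nil
      by (intro runs_branch_empty runs_instrs) auto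
  next
    case (Cons c w)
    then have "x \<noteq> y" using s1 by (auto simp: s2_def split: if_splits)
    then show ?thesis using Cons
      by (intro runs_branch_bit[of "s2(0 := [])" 3 c w]) (auto intro!: runs_instrs)
  qed
  note 4 = this
  show "\<exists>T h' s'. T \<le> poly (lin_poly 20) (input_size \<eta> xs) \<and> s' 0 = f \<eta> xs \<and>
     ?runs (compare ;; branch 2 [] [Push 3 True] [Push 3 True] ;; clear 0 ;;
        branch 3 [Push 0 True] [Push 0 False] [Push 0 False]) T 0 (stack (init \<eta> xs)) h' s'"
    unfolding s_def[symmetric]
    by (rule ex_runsI[OF runs_seq[OF 1 runs_seq[OF 2 runs_seq[OF 3 4]]]])
      (auto simp: input_size_def xs assms)
qed auto

definition zip_xor :: "instr list" where
  "zip_xor = loop 1 (branch 1 [] (branch 2 [] [Push 3 False] [Push 3 True])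
     (branch 2 [] [Push 3 True] [Push 3 False]) ;; [Pop 1, Pop 2])"

lemma zip_xor_free [simp]: "oracle_free zip_xor" "coin_free zip_xor"
  by (auto simp: zip_xor_def)

text \<open>Pushing each bit as it is produced reverses the result; the \<open>reverse 3 0\<close>
  that follows it in \<open>poly_time_xor\<close> undoes this.\<close>

lemma runs_zip_xor:
  "length (s 1) = length (s 2) \<Longrightarrow>
   runs orc \<rho> zip_xor (9 * length (s 1) + 1) h s h
     (s(1 := [], 2 := [], 3 := rev (map2 (\<noteq>) (s 1) (s 2)) @ s 3))"
proof (induction "s 1" arbitrary: s)
  case Nil
  then show ?case
    using runs_loop_empty[of s 1 orc \<rho> _ h] by (simp add: zip_xor_def fun_upd_idem)
next
  note One_nat_def [simp del]
  case (Cons x w)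
  have x: "s 1 = x # w" using Cons.hyps(2) by simp
  then obtain y v where y: "s 2 = y # v" "length w = length v"
    using Cons.prems by (cases "s 2") auto
  let ?B = "branch 1 [] (branch 2 [] [Push 3 False] [Push 3 True])
     (branch 2 [] [Push 3 True] [Push 3 False])"
  define s1 where "s1 = s(3 := (x \<noteq> y) # s 3)"
  define s2 where "s2 = s1(1 := w, 2 := v)"
  have "runs orc \<rho> (if x then branch 2 [] [Push 3 True] [Push 3 False]
      else branch 2 [] [Push 3 False] [Push 3 True]) (1 + 2) h s h s1"
    by (cases x; simp only: if_True if_False; rule runs_branch_bit[of s 2, OF y(1)]; cases y; rule runs_instrs)
      (auto simp: s1_def)
  then have 1: "runs orc \<rho> ?B (1 + 2 + 2) h s h s1"
    by (rule runs_branch_bit[of s 1, OF x])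
  have 2: "runs orc \<rho> [Pop 1, Pop 2] 2 h s1 h s2"
    by (rule runs_instrs) (auto simp: s1_def s2_def x y)
  have 3: "runs orc \<rho> zip_xor (9 * length w + 1) h s2 h
     (s(1 := [], 2 := [], 3 := rev (map2 (\<noteq>) (s 1) (s 2)) @ s 3))"
  proof -
    have e: "s(1 := [], 2 := [], 3 := rev (map2 (\<noteq>) (s 1) (s 2)) @ s 3) =
      s2(1 := [], 2 := [], 3 := rev (map2 (\<noteq>) (s2 1) (s2 2)) @ s2 3)"
      by (auto simp: s2_def s1_def x y)
    show ?thesis
      unfolding e using Cons.hyps(1)[of s2] y by (auto simp: s2_def)
  qed
  have "runs orc \<rho> zip_xor (1 + 2 + 2 + 2 + (9 * length w + 1) + 2) h s h
     (s(1 := [], 2 := [], 3 := rev (map2 (\<noteq>) (s 1) (s 2)) @ s 3))"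
    unfolding zip_xor_def using x
    by (intro runs_loop_step[OF _ runs_seq[OF 1 2] 3[unfolded zip_xor_def]]) simp
  then show ?case
    by (rule runs_mono) (simp add: x)
qed

lemma poly_time_xor:
  assumes "\<And>\<eta> x y. length x = \<eta> \<Longrightarrow> length y = \<eta> \<Longrightarrow> f \<eta> [x, y] = map2 (\<noteq>) x y"
  shows "poly_time (args_dom [NonceS, NonceS]) f"
proof (rule poly_timeI[where P = "clear 0 ;; zip_xor ;; reverse 3 0" and p = "lin_poly 20"])
  note One_nat_def [simp del]
  let ?runs = "runs (\<lambda>_. []) (\<lambda>_. False)"
  fix \<eta> xs assume "xs \<in> args_dom [NonceS, NonceS] \<eta>"
  then obtain x y where xs: "xs = [x, y]" "length x = \<eta>" "length y = \<eta>"
    by (auto dest!: args_domD)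
  define s where "s = stack (init \<eta> xs)"
  define s1 where "s1 = s(0 := [])"
  define s2 where "s2 = s1(1 := [], 2 := [], 3 := rev (map2 (\<noteq>) x y))"
  have s: "s 0 = replicate \<eta> True" "s1 1 = x" "s1 2 = y" "s1 3 = []"
    by (simp_all add: s_def s1_def stack_init xs)
  have 1: "?runs (clear 0) (3 * \<eta> + 1) 0 s 0 s1"
    using runs_clear[of _ _ 0 s 0] by (simp add: s s1_def)
  have 2: "?runs zip_xor (9 * \<eta> + 1) 0 s1 0 s2"
    using runs_zip_xor[of s1 _ _ 0] xs by (simp add: s s2_def)
  have 3: "?runs (reverse 3 0) (6 * \<eta> + 1) 0 s2 0 (s2(3 := [], 0 := map2 (\<noteq>) x y))"
    using runs_reverse[of 3 0 _ _ s2 0] xs by (simp add: s2_def s1_def)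
  show "\<exists>T h' s'. T \<le> poly (lin_poly 20) (input_size \<eta> xs) \<and> s' 0 = f \<eta> xs \<and>
     ?runs (clear 0 ;; zip_xor ;; reverse 3 0) T 0 (stack (init \<eta> xs)) h' s'"
    unfolding s_def[symmetric]
    by (rule ex_runsI[OF runs_seq[OF 1 runs_seq[OF 2 3]]])
      (auto simp: input_size_def xs assms)
qed auto


section \<open>Simulating a program with a stream of the random tape\<close>

text \<open>The head moves forward only by pushing a bit, so the bit is read and dropped at once.
  \<open>nops\<close> takes the same number of instructions without moving the head, which makes
  blocks of equal size possible.\<close>

definition skips :: "nat \<Rightarrow> instr list" where
  "skips n = concat (replicate n [Coin 0, Pop 0])"

definition nops :: "nat \<Rightarrow> instr list" where
  "nops n = concat (replicate n [Push 0 True, Pop 0])"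

lemma length_skips_nops [simp]: "length (skips n) = 2 * n" "length (nops n) = 2 * n"
  by (induction n) (auto simp: skips_def nops_def)

lemma straight_skips_nops [simp]: "straight (skips n)" "straight (nops n)"
  by (induction n) (auto simp: skips_def nops_def)

lemma fold_skips [simp]:
  "fold (exec_instr orc \<rho>) (skips n) c = c\<lparr>pc := pc c + 2 * n, head := head c + n\<rparr>"
  by (induction n arbitrary: c) (auto simp: skips_def)

lemma fold_nops [simp]:
  "fold (exec_instr orc \<rho>) (nops n) c = c\<lparr>pc := pc c + 2 * n\<rparr>"
  by (induction n arbitrary: c) (auto simp: nops_def)

text \<open>An oracle-free program is simulated on the stacks \<open>ren i\<close>, with the positions
  \<open>i * Suc d + r\<close> of the random tape as its own tape. Every instruction becomes a block of
  \<open>2 * d + 1\<close> instructions, which makes the jump targets easy to translate.\<close>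

fun block :: "nat \<Rightarrow> nat \<Rightarrow> (nat \<Rightarrow> nat) \<Rightarrow> nat \<Rightarrow> instr \<Rightarrow> instr list" where
  "block d r ren l (Push i b) = Push (ren i) b # nops d"
| "block d r ren l (Pop i) = Pop (ren i) # nops d"
| "block d r ren l (Branch i x y z) =
     Branch (ren i) (min x l * (2 * d + 1)) (min y l * (2 * d + 1)) (min z l * (2 * d + 1)) # nops d"
| "block d r ren l (Coin i) = Coin (ren i) # skips d"
| "block d r ren l Rewind = Rewind # skips r @ nops (d - r)"
| "block d r ren l (Query i j) = Rewind # nops d"

definition embed :: "nat \<Rightarrow> nat \<Rightarrow> (nat \<Rightarrow> nat) \<Rightarrow> instr list \<Rightarrow> instr list" where
  "embed d r ren P = concat (map (block d r ren (length P)) P)"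

lemma length_block: "r \<le> d \<Longrightarrow> length (block d r ren l x) = 2 * d + 1"
  by (cases x) auto

lemma straight_block: "\<not> is_branch x \<Longrightarrow> straight (block d r ren l x)"
  by (cases x) auto

lemma length_concat_const:
  "(\<And>x. length (f x) = n) \<Longrightarrow> length (concat (map f xs)) = length xs * n"
  by (induction xs) auto

lemma length_embed: "r \<le> d \<Longrightarrow> length (embed d r ren P) = length P * (2 * d + 1)"
  unfolding embed_def by (rule length_concat_const) (rule length_block)

lemma code_at_embed:
  assumes "code_at Q b (embed d r ren P)" "r \<le> d" "i < length P"
  shows "\<exists>X Y. code_at Q b (X @ block d r ren (length P) (P ! i) @ Y) \<and> length X = i * (2 * d + 1)"
proof -
  let ?f = "block d r ren (length P)"
  have "embed d r ren P = concat (map ?f (take i P @ P ! i # drop (Suc i) P))"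
    using assms(3) by (simp add: embed_def id_take_nth_drop[symmetric])
  also have "\<dots> = concat (map ?f (take i P)) @ ?f (P ! i) @ concat (map ?f (drop (Suc i) P))"
    by simp
  finally have "code_at Q b (concat (map ?f (take i P)) @ ?f (P ! i) @ concat (map ?f (drop (Suc i) P)))"
    using assms(1) by simp
  moreover have "length (concat (map ?f (take i P))) = i * (2 * d + 1)"
    using assms(2,3) by (subst length_concat_const[of _ "2 * d + 1"]) (auto simp: length_block)
  ultimately show ?thesis by blast
qed

text \<open>The \<open>min\<close> identifies all addresses outside the simulated program: wherever
  it jumps in order to halt, the host arrives at the end of the embedding. The last conjunct is the
  frame condition for the other stacks.\<close>

definition sim :: "nat \<Rightarrow> nat \<Rightarrow> (nat \<Rightarrow> nat) \<Rightarrow> nat \<Rightarrow> nat \<Rightarrow> (nat \<Rightarrow> bits) \<Rightarrow> config \<Rightarrow> config \<Rightarrow> bool" where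
  "sim d r ren b l s c c' \<longleftrightarrow>
     pc c' = b + min (pc c) l * (2 * d + 1) \<and> head c' = head c * Suc d + r \<and>
     (\<forall>i. stack c' (ren i) = stack c i) \<and> (\<forall>i. i \<notin> range ren \<longrightarrow> stack c' i = s i)"

text \<open>A coin-free program never looks at \<open>\<rho>'\<close>, so the tape matters only in
  the other case, where it must be the stream of offset \<open>r\<close> and step
  \<open>Suc d\<close>. The oracles are unrelated because \<open>P\<close> asks nothing.\<close>

lemma sim_step:
  assumes "code_at Q b (embed d r ren P)" "r \<le> d" "inj ren" "oracle_free P"
    and tape: "coin_free P \<or> \<rho>' = (\<lambda>i. \<rho> (i * Suc d + r))"
    and sim: "sim d r ren b (length P) s c c'"
  shows "\<exists>n\<le>2 * d + 1. sim d r ren b (length P) s (step o' \<rho>' P c) ((step orc \<rho> Q ^^ n) c')"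
proof (cases "pc c < length P")
  case False
  then show ?thesis using sim by (intro exI[of _ 0]) (simp add: step_def)
next
  case True
  let ?x = "P ! pc c"
  obtain X Y where XY: "code_at Q b (X @ block d r ren (length P) ?x @ Y)"
      "length X = pc c * (2 * d + 1)"
    using code_at_embed[OF assms(1,2) True] by blast
  have pcc: "pc c' = b + length X"
    using sim True XY(2) by (simp add: sim_def)
  have noq: "?x \<noteq> Query i j" for i j
    using assms(4) True nth_mem by (fastforce simp: oracle_free_def)
  show ?thesis
  proof (cases "is_branch ?x")
    case br: True
    then obtain i x y z where x: "?x = Branch i x y z"
      by (cases ?x) auto
    have I: "Q ! pc c' = relocate b (hd (block d r ren (length P) ?x))" "pc c' < length Q"
      using code_at_instr[of Q b X _ "tl (block d r ren (length P) ?x) @ Y", OF _ refl] XY(1)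
      by (simp_all add: x pcc)
    \<comment> \<open>One step of the host suffices: the jump goes directly to the start of the
      target block, past the padding.\<close>
    show ?thesis
      using sim I True
      by (intro exI[of _ 1]) (auto simp: sim_def x step_def split: list.splits)
  next
    case nb: False
    let ?B = "block d r ren (length P) ?x"
    have "code_at Q (pc c') ?B"
    proof -
      have "code_at Q b ((X @ ?B) @ Y)" using XY(1) by simp
      then have "code_at Q b (X @ map (relocate (length X)) ?B)"
        using code_at_append1 straight_block[OF nb] by fastforce
      then show ?thesis
        unfolding pcc by (rule code_at_append2) simp
    qed
    then have st: "(step orc \<rho> Q ^^ length ?B) c' = fold (exec_instr orc \<rho>) ?B c'"
      using straight_block[OF nb] by (intro steps_straight) auto
    have st': "step o' \<rho>' P c = exec_instr o' \<rho>' ?x c"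
      using True by (simp add: step_def)
    have nocoin: "?x = Coin i \<Longrightarrow> \<rho>' = (\<lambda>i. \<rho> (i * Suc d + r))" for i
      using tape True nth_mem by (fastforce simp: coin_free_def)
    have "sim d r ren b (length P) s (exec_instr o' \<rho>' ?x c) (fold (exec_instr orc \<rho>) ?B c')"
      using sim True nb noq assms(2,3) nocoin
      by (cases ?x) (auto simp: sim_def inj_eq algebra_simps)
    then have "sim d r ren b (length P) s (step o' \<rho>' P c) ((step orc \<rho> Q ^^ length ?B) c')"
      unfolding st st' .
    then show ?thesis
      using length_block[OF assms(2), of ren "length P" ?x] by (metis order_refl)
  qed
qed

lemma sim_steps:
  assumes "code_at Q b (embed d r ren P)" "r \<le> d" "inj ren" "oracle_free P"
    and tape: "coin_free P \<or> \<rho>' = (\<lambda>i. \<rho> (i * Suc d + r))"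
    and sim: "sim d r ren b (length P) s c c'"
  shows "\<exists>n\<le>T * (2 * d + 1).
    sim d r ren b (length P) s ((step o' \<rho>' P ^^ T) c) ((step orc \<rho> Q ^^ n) c')"
proof (induction T)
  case 0
  then show ?case using sim by auto
next
  case (Suc T)
  then obtain n where n: "n \<le> T * (2 * d + 1)"
    "sim d r ren b (length P) s ((step o' \<rho>' P ^^ T) c) ((step orc \<rho> Q ^^ n) c')"
    by blast
  obtain m where m: "m \<le> 2 * d + 1"
    "sim d r ren b (length P) s (step o' \<rho>' P ((step o' \<rho>' P ^^ T) c))
       ((step orc \<rho> Q ^^ m) ((step orc \<rho> Q ^^ n) c'))"
    using sim_step[OF assms(1-5) n(2)] by blast
  then show ?case
    using n(1) by (intro exI[of _ "m + n"]) (auto simp: funpow_add)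
qed

text \<open>The head of the host may stand anywhere, so it is first brought to position
  \<open>r\<close>, which represents position 0 of the stream.\<close>

lemma runs_embed:
  assumes "r \<le> d" "inj ren" "oracle_free P"
    and tape: "coin_free P \<or> \<rho>' = (\<lambda>i. \<rho> (i * Suc d + r))"
    and halt: "halts_with o' \<rho>' P \<eta> xs T st"
    and s: "\<And>i. s (ren i) = stack (init \<eta> xs) i"
  shows "\<exists>h' s'. runs orc \<rho> ((Rewind # skips r) ;; embed d r ren P) (1 + 2 * r + T * (2 * d + 1)) h s h' s' \<and>
     (\<forall>i. s' (ren i) = st i) \<and> (\<forall>i. i \<notin> range ren \<longrightarrow> s' i = s i)"
proof -
  have 1: "runs orc \<rho> (Rewind # skips r) (1 + 2 * r) h s r s"
    by (rule runs_instrs) auto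
  let ?c = "(step o' \<rho>' P ^^ T) (init \<eta> xs)"
  define s' where "s' i = (if i \<in> range ren then st (inv ren i) else s i)" for i
  have "runs orc \<rho> (embed d r ren P) (T * (2 * d + 1)) r s (head ?c * Suc d + r) s'"
    unfolding runs_def
  proof (intro allI impI)
    fix Q b assume c: "code_at Q b (embed d r ren P)"
    have "sim d r ren b (length P) s (init \<eta> xs) \<lparr>pc = b, head = r, stack = s\<rparr>"
      using s by (simp add: sim_def) (simp add: init_def)
    from sim_steps[OF c assms(1-4) this]
    obtain n where n: "n \<le> T * (2 * d + 1)"
      "sim d r ren b (length P) s ?c ((step orc \<rho> Q ^^ n) \<lparr>pc = b, head = r, stack = s\<rparr>)"
      by blast
    define c' where "c' = (step orc \<rho> Q ^^ n) \<lparr>pc = b, head = r, stack = s\<rparr>"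
    have h: "length P \<le> pc ?c" "stack ?c = st"
      using halt by (auto simp: halts_with_def Let_def)
    have "stack c' i = s' i" for i
      using n(2) h(2) assms(2) unfolding c'_def[symmetric] by (auto simp: sim_def s'_def)
    then have "c' = \<lparr>pc = b + length (embed d r ren P), head = head ?c * Suc d + r, stack = s'\<rparr>"
      using n(2) h unfolding c'_def[symmetric]
      by (cases c') (auto simp: sim_def length_embed[OF assms(1)])
    then show "\<exists>n\<le>T * (2 * d + 1). (step orc \<rho> Q ^^ n) \<lparr>pc = b, head = r, stack = s\<rparr> =
       \<lparr>pc = b + length (embed d r ren P), head = head ?c * Suc d + r, stack = s'\<rparr>"
      using n(1) by (auto simp: c'_def)
  qed
  from runs_seq[OF 1 this] show ?thesis
    using assms(2) by (intro exI[of _ "head ?c * Suc d + r"] exI[of _ s']) (auto simp: s'_def)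
qed

text \<open>Only an oracle answer could lengthen a stack by more than one bit. Output lengths are
  therefore bounded through the running time, which keeps the inputs of later programs
  polynomial.\<close>

lemma length_stack_step:
  assumes "oracle_free P"
  shows "length (stack (step orc \<rho> P c) i) \<le> Suc (length (stack c i))"
proof (cases "pc c < length P")
  case True
  then have "\<forall>i j. P ! pc c \<noteq> Query i j"
    using assms nth_mem by (fastforce simp: oracle_free_def)
  then show ?thesis
    using True by (cases "P ! pc c") (auto simp: step_def)
qed (simp add: step_def)

lemma length_stack_steps:
  assumes "oracle_free P"
  shows "length (stack ((step orc \<rho> P ^^ T) c) i) \<le> T + length (stack c i)"
proof (induction T)
  case (Suc T)
  then show ?case
    using length_stack_step[OF assms, of orc \<rho> "(step orc \<rho> P ^^ T) c" i] by simp
qed simp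

lemma length_halts_with:
  assumes "oracle_free P" "halts_with orc \<rho> P \<eta> xs T st"
  shows "length (st 0) \<le> T + \<eta>"
  using length_stack_steps[OF assms(1), of T orc \<rho> "init \<eta> xs" 0] assms(2)
  by (auto simp: halts_with_def Let_def stack_init)

section \<open>Values computable by the adversary\<close>

lemma poly_nat_mono: "x \<le> y \<Longrightarrow> poly p x \<le> poly (p :: nat poly) y"
  by (induction p) (auto intro: add_mono mult_mono)

text \<open>A value \<open>v\<close> may depend on the security parameter, the hidden key and the random tape; the
  program may use the stacks in \<open>R\<close>, which are empty at the start, and reads \<open>1\<^sup>\<eta>\<close> from stack \<open>E\<close>.\<close>

definition computes :: "(nat \<Rightarrow> bits \<Rightarrow> bits \<Rightarrow> bits) \<Rightarrow> nat set \<Rightarrow> nat \<Rightarrow> instr list \<Rightarrow> nat poly \<Rightarrow>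
    (nat \<Rightarrow> bits \<Rightarrow> tape \<Rightarrow> (nat \<Rightarrow> bits) \<Rightarrow> (nat \<Rightarrow> bits) \<Rightarrow> bool) \<Rightarrow> bool" where
  "computes h R E C p Q \<longleftrightarrow> (\<forall>\<eta> key \<rho> h0 s. length key = \<eta> \<longrightarrow> s E = replicate \<eta> True \<longrightarrow>
     (\<forall>i\<in>R. s i = []) \<longrightarrow>
     (\<exists>h' s'. runs (\<lambda>m. h \<eta> m key) \<rho> C (poly p \<eta>) h0 s h' s' \<and> Q \<eta> key \<rho> s s'))"

lemma computesI:
  assumes "\<And>\<eta> key \<rho> h0 s. length key = \<eta> \<Longrightarrow> s E = replicate \<eta> True \<Longrightarrow> (\<forall>i\<in>R. s i = []) \<Longrightarrow>
     \<exists>h' s'. runs (\<lambda>m. h \<eta> m key) \<rho> C (poly p \<eta>) h0 s h' s' \<and> Q \<eta> key \<rho> s s'"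
  shows "computes h R E C p Q"
  using assms by (simp add: computes_def)

lemma computesE:
  assumes "computes h R E C p Q" "length key = \<eta>" "s E = replicate \<eta> True" "\<forall>i\<in>R. s i = []"
  obtains h' s' where "runs (\<lambda>m. h \<eta> m key) \<rho> C (poly p \<eta>) h0 s h' s'" "Q \<eta> key \<rho> s s'"
proof -
  have "\<exists>h' s'. runs (\<lambda>m. h \<eta> m key) \<rho> C (poly p \<eta>) h0 s h' s' \<and> Q \<eta> key \<rho> s s'"
    using assms unfolding computes_def by (elim allE impE) assumption+
  then show ?thesis using that by (elim exE conjE)
qed

text \<open>The work space is an arbitrary infinite set of stacks, so that it can be divided among
  subterms. The length bound belongs to the notion because the value may become an input of another
  program, and \<open>E\<close> lies outside \<open>R\<close> so that the unary parameter
  survives.\<close>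

definition computable ::
  "(nat \<Rightarrow> bits \<Rightarrow> bits \<Rightarrow> bits) \<Rightarrow> (nat \<Rightarrow> bits \<Rightarrow> tape \<Rightarrow> bits) \<Rightarrow> bool" where
  "computable h v \<longleftrightarrow> (\<forall>R r E. infinite R \<longrightarrow> r \<in> R \<longrightarrow> E \<notin> R \<longrightarrow>
     (\<exists>C p. computes h R E C p (\<lambda>\<eta> key \<rho> s s'.
        s' r = v \<eta> key \<rho> \<and> length (v \<eta> key \<rho>) \<le> poly p \<eta> \<and> (\<forall>i. i \<notin> R \<longrightarrow> s' i = s i))))"

lemma computableE:
  assumes "computable h v" "infinite R" "r \<in> R" "E \<notin> R"
  obtains C p where "computes h R E C p (\<lambda>\<eta> key \<rho> s s'.
    s' r = v \<eta> key \<rho> \<and> length (v \<eta> key \<rho>) \<le> poly p \<eta> \<and> (\<forall>i. i \<notin> R \<longrightarrow> s' i = s i))"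
  using assms(1)[unfolded computable_def, rule_format, OF assms(2-4)] that by (elim exE)

text \<open>The unary number on \<open>E\<close> is the loop counter; it is saved on
  \<open>t\<close> and put back for later fragments.\<close>

definition tally :: "nat \<Rightarrow> nat \<Rightarrow> instr list \<Rightarrow> instr list" where
  "tally E t B = loop E (Pop E # Push t True # B) ;; move t E True"

lemma runs_copy:
  assumes "distinct [E, t, r]" "s E = replicate n True" "s t = []" "s r = []"
  shows "runs orc \<rho> (tally E t [Push r True]) (9 * n + 2) h s h (s(r := replicate n True))"
proof -
  have 1: "runs orc \<rho> (loop E (Pop E # Push t True # [Push r True])) (5 * n + 1) h s h
     (s(E := [], t := replicate n True @ s t, r := replicate n True @ s r))"
    if "s E = replicate n True" for n s
    using that
  proof (induction n arbitrary: s)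
    case 0
    then show ?case
      using runs_loop_empty[of s E orc \<rho> _ h] by (simp add: fun_upd_idem)
  next
    case (Suc n)
    define s1 where "s1 = s(E := replicate n True, t := True # s t, r := True # s r)"
    have 1: "runs orc \<rho> (Pop E # Push t True # [Push r True]) 3 h s h s1"
      using Suc.prems assms(1) by (intro runs_instrs[OF refl]) (auto simp: s1_def)
    have e: "s(E := [], t := replicate (Suc n) True @ s t, r := replicate (Suc n) True @ s r) =
        s1(E := [], t := replicate n True @ s1 t, r := replicate n True @ s1 r)"
      using assms(1) by (auto simp: s1_def replicate_app_Cons_same fun_eq_iff)
    have 2: "runs orc \<rho> (loop E (Pop E # Push t True # [Push r True])) (5 * n + 1) h s1 h
      (s1(E := [], t := replicate n True @ s1 t, r := replicate n True @ s1 r))"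
      using assms(1) by (intro Suc.IH) (auto simp: s1_def)
    show ?case
      unfolding e using Suc.prems
      by (intro runs_mono[OF runs_loop_step[OF _ 1 2]]) auto
  qed
  let ?s = "s(E := [], t := replicate n True @ s t, r := replicate n True @ s r)"
  have "runs orc \<rho> (move t E True) (4 * n + 1) h ?s h (s(r := replicate n True))"
    using runs_move[of t E orc \<rho> True ?s h] assms
    by (simp add: fun_upd_twist fun_upd_idem)
  from runs_seq[OF 1[where s = s and n = n, OF assms(2)] this] show ?thesis
    unfolding tally_def by (rule runs_mono) simp
qed

text \<open>The bit read last ends on top, so entry \<open>i\<close> of the result stems from round
  \<open>n - Suc i\<close>, counted from 0. Skipping \<open>d\<close> bits after each coin stays in
  one residue class modulo \<open>Suc d\<close>.\<close>

lemma runs_read: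
  assumes "distinct [E, t, r]" "s E = replicate n True" "s t = []" "s r = []"
  shows "runs orc \<rho> (tally E t (Coin r # skips d)) ((2 * d + 9) * n + 2) h s (h + n * Suc d)
    (s(r := map (\<lambda>i. \<rho> (h + (n - Suc i) * Suc d)) [0..<n]))"
proof -
  let ?B = "Pop E # Push t True # Coin r # skips d"
  have 1: "runs orc \<rho> (loop E ?B) ((2 * d + 5) * n + 1) h s (h + n * Suc d)
     (s(E := [], t := replicate n True @ s t,
        r := map (\<lambda>i. \<rho> (h + (n - Suc i) * Suc d)) [0..<n] @ s r))"
    if "s E = replicate n True" for n s h
    using that
  proof (induction n arbitrary: s h)
    case 0
    then show ?case
      using runs_loop_empty[of s E orc \<rho> _ h] by (simp add: fun_upd_idem)
  next
    case (Suc n)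
    define s1 where "s1 = s(E := replicate n True, t := True # s t, r := \<rho> h # s r)"
    have 1: "runs orc \<rho> ?B (3 + 2 * d) h s (h + Suc d) s1"
      using Suc.prems assms(1) by (intro runs_instrs[OF refl]) (auto simp: s1_def)
    have m: "map (\<lambda>i. \<rho> (h + (Suc n - Suc i) * Suc d)) [0..<Suc n] =
        map (\<lambda>i. \<rho> (h + Suc d + (n - Suc i) * Suc d)) [0..<n] @ [\<rho> h]"
    proof -
      have "(Suc n - Suc i) * Suc d = Suc d + (n - Suc i) * Suc d" if "i < n" for i
        using that by (simp add: Suc_diff_Suc[symmetric])
      then show ?thesis by (auto simp: add.assoc)
    qed
    have e: "s(E := [], t := replicate (Suc n) True @ s t,
          r := map (\<lambda>i. \<rho> (h + (Suc n - Suc i) * Suc d)) [0..<Suc n] @ s r) =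
        s1(E := [], t := replicate n True @ s1 t,
          r := map (\<lambda>i. \<rho> (h + Suc d + (n - Suc i) * Suc d)) [0..<n] @ s1 r)"
      unfolding m using assms(1) by (auto simp: s1_def replicate_app_Cons_same fun_eq_iff)
    have 2: "runs orc \<rho> (loop E ?B) ((2 * d + 5) * n + 1) (h + Suc d) s1 (h + Suc d + n * Suc d)
      (s1(E := [], t := replicate n True @ s1 t,
          r := map (\<lambda>i. \<rho> (h + Suc d + (n - Suc i) * Suc d)) [0..<n] @ s1 r))"
      using assms(1) by (intro Suc.IH) (auto simp: s1_def)
    have "runs orc \<rho> (loop E ?B) (3 + 2 * d + ((2 * d + 5) * n + 1) + 2) h s
        (h + Suc d + n * Suc d)
        (s1(E := [], t := replicate n True @ s1 t,
          r := map (\<lambda>i. \<rho> (h + Suc d + (n - Suc i) * Suc d)) [0..<n] @ s1 r))"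
      using Suc.prems by (intro runs_loop_step[OF _ 1 2]) auto
    moreover have "3 + 2 * d + ((2 * d + 5) * n + 1) + 2 = (2 * d + 5) * Suc n + 1"
        "h + Suc d + n * Suc d = h + Suc n * Suc d"
      by (simp_all add: algebra_simps)
    ultimately show ?case
      unfolding e by (simp only:)
  qed
  let ?m = "map (\<lambda>i. \<rho> (h + (n - Suc i) * Suc d)) [0..<n]"
  let ?s = "s(E := [], t := replicate n True @ s t, r := ?m @ s r)"
  have "runs orc \<rho> (move t E True) (4 * n + 1) (h + n * Suc d) ?s (h + n * Suc d) (s(r := ?m))"
    using runs_move[of t E orc \<rho> True ?s "h + n * Suc d"] assms
    by (simp add: fun_upd_twist fun_upd_idem)
  from runs_seq[OF 1[where s = s and n = n and h = h, OF assms(2)] this] show ?thesis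
    unfolding tally_def by (rule runs_mono) (simp add: algebra_simps)
qed

text \<open>The program rewinds before reading, so repeated evaluations of one name agree.\<close>

lemma computable_read:
  "computable h (\<lambda>\<eta> key \<rho>. map (\<lambda>i. \<rho> (j + (\<eta> - Suc i) * Suc d)) [0..<\<eta>])"
  unfolding computable_def
proof (intro allI impI)
  fix R :: "nat set" and r E
  assume R: "infinite R" "r \<in> R" "E \<notin> R"
  have "infinite (R - {r})" using R by simp
  then obtain t where t: "t \<in> R" "t \<noteq> r"
    by (metis Diff_iff ex_in_conv finite.emptyI singletonI)
  let ?C = "(Rewind # skips j) ;; tally E t (Coin r # skips d)" and ?p = "[:2 * j + 3, 2 * d + 9:]"
  show "\<exists>C p. computes h R E C p (\<lambda>\<eta> key \<rho> s s'.
      s' r = map (\<lambda>i. \<rho> (j + (\<eta> - Suc i) * Suc d)) [0..<\<eta>] \<and>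
      length (map (\<lambda>i. \<rho> (j + (\<eta> - Suc i) * Suc d)) [0..<\<eta>]) \<le> poly p \<eta> \<and>
      (\<forall>i. i \<notin> R \<longrightarrow> s' i = s i))"
  proof (intro exI[of _ ?C] exI[of _ ?p] computesI)
    fix \<eta> h0 s and \<rho> :: tape and key :: bits
    assume s: "s E = replicate \<eta> True" "\<forall>i\<in>R. s i = []"
    let ?orc = "\<lambda>m. h \<eta> m key" and ?v = "map (\<lambda>i. \<rho> (j + (\<eta> - Suc i) * Suc d)) [0..<\<eta>]"
    have 1: "runs ?orc \<rho> (Rewind # skips j) (1 + 2 * j) h0 s j s"
      by (rule runs_instrs) auto
    have 2: "runs ?orc \<rho> (tally E t (Coin r # skips d)) ((2 * d + 9) * \<eta> + 2) j s
        (j + \<eta> * Suc d) (s(r := ?v))"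
      using R t s by (intro runs_read) auto
    have "runs ?orc \<rho> ?C (poly ?p \<eta>) h0 s (j + \<eta> * Suc d) (s(r := ?v))"
      by (rule runs_mono[OF runs_seq[OF 1 2]]) (simp add: algebra_simps)
    then show "\<exists>h' s'. runs ?orc \<rho> ?C (poly ?p \<eta>) h0 s h' s' \<and>
        s' r = ?v \<and> length ?v \<le> poly ?p \<eta> \<and> (\<forall>i. i \<notin> R \<longrightarrow> s' i = s i)"
      using R(2) by (intro exI[of _ "j + \<eta> * Suc d"] exI[of _ "s(r := ?v)"] conjI)
        (auto simp: algebra_simps)
  qed
qed

lemma runs_query: "runs orc \<rho> [Query i j] 1 h s h (s(j := orc (s i)))"
  by (rule runs_instrs[OF refl]) auto

text \<open>A query costs one step whatever the length of its answer, so the length bound has to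
  come from the hypothesis on \<open>h\<close>.\<close>

lemma computable_hash:
  assumes v: "computable h v"
    and h: "\<And>\<eta> m key. length key = \<eta> \<Longrightarrow> length (h \<eta> m key) = \<eta>"
  shows "computable h (\<lambda>\<eta> key \<rho>. h \<eta> (v \<eta> key \<rho>) key)"
  unfolding computable_def
proof (intro allI impI)
  fix R :: "nat set" and r E
  assume R: "infinite R" "r \<in> R" "E \<notin> R"
  have inf: "infinite (R - {r})" "E \<notin> R - {r}" using R by auto
  then obtain t where t: "t \<in> R - {r}"
    by (metis ex_in_conv finite.emptyI)
  obtain C p where C: "computes h (R - {r}) E C p (\<lambda>\<eta> key \<rho> s s'.
      s' t = v \<eta> key \<rho> \<and> length (v \<eta> key \<rho>) \<le> poly p \<eta> \<and> (\<forall>i. i \<notin> R - {r} \<longrightarrow> s' i = s i))"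
    by (rule computableE[OF v inf(1) t inf(2)])
  let ?C = "C ;; [Query t r]" and ?p = "p + [:1, 1:]"
  show "\<exists>C p. computes h R E C p (\<lambda>\<eta> key \<rho> s s'. s' r = h \<eta> (v \<eta> key \<rho>) key \<and>
      length (h \<eta> (v \<eta> key \<rho>) key) \<le> poly p \<eta> \<and> (\<forall>i. i \<notin> R \<longrightarrow> s' i = s i))"
  proof (intro exI[of _ ?C] exI[of _ ?p] computesI)
    fix \<eta> h0 s and \<rho> :: tape and key :: bits
    assume s: "length key = \<eta>" "s E = replicate \<eta> True" "\<forall>i\<in>R. s i = []"
    let ?orc = "\<lambda>m. h \<eta> m key" and ?v = "h \<eta> (v \<eta> key \<rho>) key"
    have s0: "\<forall>i\<in>R - {r}. s i = []" using s(3) by simp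
    obtain h1 s1 where s1: "runs ?orc \<rho> C (poly p \<eta>) h0 s h1 s1"
        "s1 t = v \<eta> key \<rho> \<and> length (v \<eta> key \<rho>) \<le> poly p \<eta> \<and> (\<forall>i. i \<notin> R - {r} \<longrightarrow> s1 i = s i)"
      by (rule computesE[OF C s(1,2) s0])
    have "runs ?orc \<rho> [Query t r] 1 h1 s1 h1 (s1(r := ?v))"
      using runs_query[of ?orc \<rho> t r h1 s1] s1(2) by simp
    from runs_seq[OF s1(1) this]
    have "runs ?orc \<rho> ?C (poly ?p \<eta>) h0 s h1 (s1(r := ?v))"
      by (rule runs_mono) simp
    then show "\<exists>h' s'. runs ?orc \<rho> ?C (poly ?p \<eta>) h0 s h' s' \<and>
        s' r = ?v \<and> length ?v \<le> poly ?p \<eta> \<and> (\<forall>i. i \<notin> R \<longrightarrow> s' i = s i)"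
      using s1(2) R(2) h[OF s(1)]
      by (intro exI[of _ h1] exI[of _ "s1(r := ?v)"] conjI) auto
  qed
qed

lemma infinite_split:
  fixes R :: "nat set"
  assumes "infinite R"
  obtains A B where "A \<union> B \<subseteq> R" "A \<inter> B = {}" "infinite A" "infinite B"
proof
  let ?e = "enumerate R"
  have inj: "inj ?e" using assms by (simp add: inj_enumerate)
  show "range (\<lambda>n. ?e (2 * n)) \<union> range (\<lambda>n. ?e (2 * n + 1)) \<subseteq> R"
    using enumerate_in_set[OF assms] by auto
  show "range (\<lambda>n. ?e (2 * n)) \<inter> range (\<lambda>n. ?e (2 * n + 1)) = {}"
    using injD[OF inj] by (auto dest!: injD[OF inj]) presburger
  show "infinite (range (\<lambda>n. ?e (2 * n)))" "infinite (range (\<lambda>n. ?e (2 * n + 1)))"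
    using injD[OF inj] by (auto intro!: range_inj_infinite injI dest!: injD[OF inj])
qed

text \<open>Each value gets an infinite half of the remaining stacks, so earlier results stay
  intact. The untouched infinite set \<open>R'\<close> provides the work stacks of a program that is
  applied to these values.\<close>

lemma computable_list:
  assumes "\<And>v. v \<in> set vs \<Longrightarrow> computable h v"
    and "infinite R" "E \<notin> R"
  obtains rs R' C p where "length rs = length vs" "distinct rs" "set rs \<subseteq> R"
    "R' \<subseteq> R" "infinite R'" "R' \<inter> set rs = {}"
    "computes h R E C p (\<lambda>\<eta> key \<rho> s s'. map s' rs = map (\<lambda>v. v \<eta> key \<rho>) vs \<and>
       sum_list (map (\<lambda>v. length (v \<eta> key \<rho>)) vs) \<le> poly p \<eta> \<and> (\<forall>i. i \<notin> R \<or> i \<in> R' \<longrightarrow> s' i = s i))"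
  using assms
proof (induction vs arbitrary: R thesis)
  case Nil
  have "runs orc \<rho> [] 0 h0 s h0 s" for orc \<rho> h0 s
    by (rule runs_instrs[OF refl]) auto
  then have "computes h R E [] 0 (\<lambda>\<eta> key \<rho> s s'. \<forall>i. s' i = s i)"
    by (intro computesI) force
  with Nil.prems(3) show ?case
    by (intro Nil.prems(1)[of "[]" R "[]" 0]) (auto simp: computes_def)
next
  case (Cons v vs)
  obtain A B where AB: "A \<union> B \<subseteq> R" "A \<inter> B = {}" "infinite A" "infinite B"
    using infinite_split[OF Cons.prems(3)] by blast
  obtain t where t: "t \<in> A" using AB(3) by (metis ex_in_conv finite.emptyI)
  have E: "E \<notin> A" "E \<notin> B" using AB Cons.prems(4) by auto
  obtain C1 p1 where C1: "computes h A E C1 p1 (\<lambda>\<eta> key \<rho> s s'. s' t = v \<eta> key \<rho> \<and>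
      length (v \<eta> key \<rho>) \<le> poly p1 \<eta> \<and> (\<forall>i. i \<notin> A \<longrightarrow> s' i = s i))"
    by (rule computableE[OF Cons.prems(2)[of v] AB(3) t E(1)]) auto
  obtain rs R' C2 p2 where rs: "length rs = length vs" "distinct rs" "set rs \<subseteq> B"
      "R' \<subseteq> B" "infinite R'" "R' \<inter> set rs = {}"
    and C2: "computes h B E C2 p2 (\<lambda>\<eta> key \<rho> s s'. map s' rs = map (\<lambda>v. v \<eta> key \<rho>) vs \<and>
       sum_list (map (\<lambda>v. length (v \<eta> key \<rho>)) vs) \<le> poly p2 \<eta> \<and> (\<forall>i. i \<notin> B \<or> i \<in> R' \<longrightarrow> s' i = s i))"
    by (rule Cons.IH[OF _ _ AB(4) E(2)]) (use Cons.prems(2) in auto)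
  have tB: "t \<notin> B" "t \<in> R" using t AB by auto
  show ?case
  proof (rule Cons.prems(1)[of "t # rs" R' "C1 ;; C2" "p1 + p2"])
    show "computes h R E (C1 ;; C2) (p1 + p2) (\<lambda>\<eta> key \<rho> s s'.
       map s' (t # rs) = map (\<lambda>v. v \<eta> key \<rho>) (v # vs) \<and>
       sum_list (map (\<lambda>v. length (v \<eta> key \<rho>)) (v # vs)) \<le> poly (p1 + p2) \<eta> \<and>
       (\<forall>i. i \<notin> R \<or> i \<in> R' \<longrightarrow> s' i = s i))"
    proof (rule computesI)
      fix \<eta> h0 s and \<rho> :: tape and key :: bits
      assume s: "length key = \<eta>" "s E = replicate \<eta> True" "\<forall>i\<in>R. s i = []"
      let ?orc = "\<lambda>m. h \<eta> m key"
      have sA: "\<forall>i\<in>A. s i = []" using s(3) AB by auto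
      obtain h1 s1 where s1: "runs ?orc \<rho> C1 (poly p1 \<eta>) h0 s h1 s1"
          "s1 t = v \<eta> key \<rho> \<and> length (v \<eta> key \<rho>) \<le> poly p1 \<eta> \<and> (\<forall>i. i \<notin> A \<longrightarrow> s1 i = s i)"
        by (rule computesE[OF C1 s(1,2) sA])
      have sE: "s1 E = replicate \<eta> True" using s1(2) E(1) s(2) by simp
      have sB: "\<forall>i\<in>B. s1 i = []"
        using s(3) AB(1,2) s1(2) by (metis IntI UnI2 empty_iff subsetD)
      obtain h2 s2 where s2: "runs ?orc \<rho> C2 (poly p2 \<eta>) h1 s1 h2 s2"
          "map s2 rs = map (\<lambda>v. v \<eta> key \<rho>) vs \<and>
           sum_list (map (\<lambda>v. length (v \<eta> key \<rho>)) vs) \<le> poly p2 \<eta> \<and> (\<forall>i. i \<notin> B \<or> i \<in> R' \<longrightarrow> s2 i = s1 i)"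
        by (rule computesE[OF C2 s(1) sE sB])
      have "s2 t = v \<eta> key \<rho>" using s1(2) s2(2) tB(1) by simp
      moreover have "s2 i = s i" if "i \<notin> R \<or> i \<in> R'" for i
        using that s2(2) s1(2) AB(1,2) rs(4) by (metis IntI UnI1 UnI2 empty_iff subsetD)
      moreover have "runs ?orc \<rho> (C1 ;; C2) (poly (p1 + p2) \<eta>) h0 s h2 s2"
        using runs_seq[OF s1(1) s2(1)] by simp
      ultimately show "\<exists>h' s'. runs ?orc \<rho> (C1 ;; C2) (poly (p1 + p2) \<eta>) h0 s h' s' \<and>
         map s' (t # rs) = map (\<lambda>v. v \<eta> key \<rho>) (v # vs) \<and>
         sum_list (map (\<lambda>v. length (v \<eta> key \<rho>)) (v # vs)) \<le> poly (p1 + p2) \<eta> \<and>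
         (\<forall>i. i \<notin> R \<or> i \<in> R' \<longrightarrow> s' i = s i)"
        using s1(2) s2(2) by (intro exI[of _ h2] exI[of _ s2] conjI) auto
    qed
  qed (use rs tB AB in auto)
qed

lemma computable_apply:
  fixes p :: "nat poly"
  assumes vs: "\<And>v. v \<in> set vs \<Longrightarrow> computable h v"
    and P: "oracle_free P" "r \<le> d"
    and tape: "coin_free P \<and> \<tau> = (\<lambda>\<rho> _. False) \<or> \<tau> = (\<lambda>\<rho> i. \<rho> (i * Suc d + r))"
    and halts: "\<And>\<eta> (key :: bits) \<rho>. length key = \<eta> \<Longrightarrow> \<exists>st.
      halts_with (\<lambda>_. []) (\<tau> \<rho>) P \<eta> (map (\<lambda>v. v \<eta> key \<rho>) vs)
        (poly p (input_size \<eta> (map (\<lambda>v. v \<eta> key \<rho>) vs))) st \<and> st 0 = w \<eta> key \<rho>"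
  shows "computable h w"
  unfolding computable_def
proof (intro allI impI)
  fix R :: "nat set" and r0 E
  assume R: "infinite R" "r0 \<in> R" "E \<notin> R"
  have R0: "infinite (R - {r0})" "E \<notin> R - {r0}" using R by auto
  obtain rs R' C1 p1 where rs: "length rs = length vs" "distinct rs" "set rs \<subseteq> R - {r0}"
      "R' \<subseteq> R - {r0}" "infinite R'" "R' \<inter> set rs = {}"
    and C1: "computes h (R - {r0}) E C1 p1 (\<lambda>\<eta> key \<rho> s s'. map s' rs = map (\<lambda>v. v \<eta> key \<rho>) vs \<and>
       sum_list (map (\<lambda>v. length (v \<eta> key \<rho>)) vs) \<le> poly p1 \<eta> \<and>
       (\<forall>i. i \<notin> R - {r0} \<or> i \<in> R' \<longrightarrow> s' i = s i))"
    by (rule computable_list[OF vs R0]) auto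
  obtain t where t: "t \<in> R'" using rs(5) by (metis ex_in_conv finite.emptyI)
  let ?n = "length vs"
  \<comment> \<open>Stack 0 of the program becomes the result stack, its input stacks become the
    stacks of the computed values, and all its other stacks come from the clean set
    \<open>R'\<close>.\<close>
  define ren where "ren i = (if i \<le> ?n then (r0 # rs) ! i else enumerate R' (i - Suc ?n))" for i
  have ren_R': "i > ?n \<Longrightarrow> ren i \<in> R'" for i
    using enumerate_in_set[OF rs(5)] by (simp add: ren_def)
  have ren_rs: "i \<le> ?n \<Longrightarrow> ren i \<in> insert r0 (set rs)" for i
    using rs(1) by (auto simp: ren_def nth_Cons split: nat.splits)
  have d: "distinct (r0 # rs)" "insert r0 (set rs) \<inter> R' = {}"
    using rs by auto
  have "inj ren"
  proof (rule injI)
    fix i j assume e: "ren i = ren j"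
    then have "(i \<le> ?n) = (j \<le> ?n)"
      using ren_R'[of i] ren_R'[of j] ren_rs[of i] ren_rs[of j] d(2) by (metis disjoint_iff not_le)
    then consider "i \<le> ?n" "j \<le> ?n" | "i > ?n" "j > ?n" by linarith
    then show "i = j"
    proof cases
      case 1
      then show ?thesis
        using e nth_eq_iff_index_eq[OF d(1)] rs(1) by (simp add: ren_def)
    next
      case 2
      then have "i - Suc ?n = j - Suc ?n"
        using e injD[OF inj_enumerate[OF rs(5)]] by (simp add: ren_def)
      then show ?thesis using 2 by simp
    qed
  qed
  have range: "range ren \<subseteq> R"
  proof
    fix x assume "x \<in> range ren"
    then obtain i where "x = ren i" by blast
    then show "x \<in> R"
      using ren_R'[of i] ren_rs[of i] rs(3,4) R(2) by (cases "i \<le> ?n") auto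
  qed
  \<comment> \<open>\<open>?q\<close> bounds the time of \<open>P\<close> on inputs of total size at
    most \<open>\<eta> + poly p1 \<eta>\<close>. The summands of \<open>?p\<close> pay for the
    arguments, for the copy of the unary parameter and for the simulation, slowed down by
    \<open>2 * d + 1\<close>; the last coefficient 1 makes room for the output, which may be longer
    than the time by \<open>\<eta>\<close>.\<close>
  let ?q = "pcompose p ([:0, 1:] + p1)"
  let ?p = "p1 + [:2, 9:] + (smult (2 * d + 1) ?q + [:1 + 2 * r, 1:])"
  let ?C = "C1 ;; tally E t [Push r0 True] ;; ((Rewind # skips r) ;; embed d r ren P)"
  show "\<exists>C p. computes h R E C p (\<lambda>\<eta> key \<rho> s s'. s' r0 = w \<eta> key \<rho> \<and>
      length (w \<eta> key \<rho>) \<le> poly p \<eta> \<and> (\<forall>i. i \<notin> R \<longrightarrow> s' i = s i))"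
  proof (intro exI[of _ ?C] exI[of _ ?p] computesI)
    fix \<eta> h0 s and \<rho> :: tape and key :: bits
    assume s: "length key = \<eta>" "s E = replicate \<eta> True" "\<forall>i\<in>R. s i = []"
    let ?xs = "map (\<lambda>v. v \<eta> key \<rho>) vs"
    have sR: "\<forall>i\<in>R - {r0}. s i = []" using s(3) by auto
    obtain h1 s1 where s1: "runs (\<lambda>m. h \<eta> m key) \<rho> C1 (poly p1 \<eta>) h0 s h1 s1"
        "map s1 rs = ?xs \<and> sum_list (map (\<lambda>v. length (v \<eta> key \<rho>)) vs) \<le> poly p1 \<eta> \<and>
         (\<forall>i. i \<notin> R - {r0} \<or> i \<in> R' \<longrightarrow> s1 i = s i)"
      by (rule computesE[OF C1 s(1,2) sR])
    define s2 where "s2 = s1(r0 := replicate \<eta> True)"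
    have "distinct [E, t, r0]" "s1 E = replicate \<eta> True" "s1 t = []" "s1 r0 = []"
      using R s t rs(4) s1(2) by auto
    then have 2: "runs (\<lambda>m. h \<eta> m key) \<rho> (tally E t [Push r0 True]) (9 * \<eta> + 2) h1 s1 h1 s2"
      unfolding s2_def by (rule runs_copy)
    have "input_size \<eta> ?xs \<le> \<eta> + poly p1 \<eta>"
      using s1(2) by (simp add: input_size_def o_def)
    then have T: "poly p (input_size \<eta> ?xs) \<le> poly ?q \<eta>"
      using poly_nat_mono by (simp add: poly_pcompose)
    obtain st where st: "halts_with (\<lambda>_. []) (\<tau> \<rho>) P \<eta> ?xs (poly p (input_size \<eta> ?xs)) st"
        "st 0 = w \<eta> key \<rho>"
      using halts[OF s(1)] by blast
    have "s2 (ren i) = stack (init \<eta> ?xs) i" for i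
    proof (cases "i \<le> ?n")
      case True
      show ?thesis
      proof (cases i)
        case 0
        then show ?thesis by (simp add: ren_def s2_def stack_init)
      next
        case (Suc j)
        then have j: "j < length rs" "j < ?n" using True rs(1) by auto
        then have "s1 (rs ! j) = ?xs ! j" using s1(2) by (metis nth_map)
        moreover have "rs ! j \<noteq> r0" using j d(1) nth_mem by fastforce
        ultimately show ?thesis using Suc j by (simp add: ren_def s2_def stack_init)
      qed
    next
      case False
      then show ?thesis
        using ren_R'[of i] s1(2) rs(4) s(3) by (auto simp: s2_def stack_init)
    qed
    then obtain h' s' where s': "runs (\<lambda>m. h \<eta> m key) \<rho> ((Rewind # skips r) ;; embed d r ren P)
        (1 + 2 * r + poly p (input_size \<eta> ?xs) * (2 * d + 1)) h1 s2 h' s'"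
        "\<forall>i. s' (ren i) = st i" "\<forall>i. i \<notin> range ren \<longrightarrow> s' i = s2 i"
      using runs_embed[OF P(2) \<open>inj ren\<close> P(1) _ st(1), of \<rho> s2] tape by blast
    have "length (w \<eta> key \<rho>) \<le> poly ?p \<eta>"
    proof -
      have "length (w \<eta> key \<rho>) \<le> poly ?q \<eta> + \<eta>"
        using length_halts_with[OF P(1) st(1)] st(2) T by simp
      then show ?thesis by (simp add: algebra_simps)
    qed
    moreover have "runs (\<lambda>m. h \<eta> m key) \<rho> ?C (poly ?p \<eta>) h0 s h' s'"
    proof (rule runs_mono[OF runs_seq[OF s1(1) runs_seq[OF 2 s'(1)]]])
      have "poly p (input_size \<eta> ?xs) * (2 * d + 1) \<le> (2 * d + 1) * poly ?q \<eta>"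
        using T by (metis mult.commute mult_le_mono2)
      then show "poly p1 \<eta> + (9 * \<eta> + 2 + (1 + 2 * r + poly p (input_size \<eta> ?xs) * (2 * d + 1))) \<le> poly ?p \<eta>"
        unfolding poly_add poly_smult by simp
    qed
    moreover have "s' r0 = w \<eta> key \<rho>"
      using s'(2)[rule_format, of 0] st(2) by (simp add: ren_def)
    moreover have "s' i = s i" if "i \<notin> R" for i
    proof -
      have "i \<notin> range ren" "i \<noteq> r0" using that range R(2) by auto
      then show ?thesis using that s'(3) s1(2) by (simp add: s2_def)
    qed
    ultimately show "\<exists>h' s'. runs (\<lambda>m. h \<eta> m key) \<rho> ?C (poly ?p \<eta>) h0 s h' s' \<and>
        s' r0 = w \<eta> key \<rho> \<and> length (w \<eta> key \<rho>) \<le> poly ?p \<eta> \<and> (\<forall>i. i \<notin> R \<longrightarrow> s' i = s i)"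
      by (intro exI[of _ h'] exI[of _ s'] conjI allI impI)
  qed
qed


text \<open>Stacks 0 and 1 are where \<open>cr_hk\<close> expects the output. The unary parameter
  moves from stack 0 to stack 2; the even stacks other than 2 and the odd ones serve the two
  computations separately.\<close>

lemma reduction_program:
  assumes v: "computable h v" and w: "computable h w"
  obtains P and p :: "nat poly" where "\<forall>\<eta> key \<rho>. length key = \<eta> \<longrightarrow> (\<exists>st.
    halts_with (\<lambda>m. h \<eta> m key) \<rho> P \<eta> [] (poly p \<eta>) st \<and> st 0 = v \<eta> key \<rho> \<and> st 1 = w \<eta> key \<rho>)"
proof -
  define A where "A = {i :: nat. even i \<and> i \<noteq> 2}"
  define B where "B = {i :: nat. odd i}"
  have "range (\<lambda>i. 2 * i + 4) \<subseteq> A" "range (\<lambda>i. 2 * i + 1) \<subseteq> B"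
    by (auto simp: A_def B_def)
  moreover have "infinite (range (\<lambda>i :: nat. 2 * i + 4))" "infinite (range (\<lambda>i :: nat. 2 * i + 1))"
    by (auto intro!: range_inj_infinite injI)
  ultimately have inf: "infinite A" "infinite B"
    using finite_subset by blast+
  have mem: "0 \<in> A" "2 \<notin> A" "1 \<in> B" "2 \<notin> B" "A \<inter> B = {}"
    by (auto simp: A_def B_def)
  obtain C p where C: "computes h A 2 C p (\<lambda>\<eta> key \<rho> s s'.
      s' 0 = v \<eta> key \<rho> \<and> length (v \<eta> key \<rho>) \<le> poly p \<eta> \<and> (\<forall>i. i \<notin> A \<longrightarrow> s' i = s i))"
    by (rule computableE[OF v inf(1) mem(1,2)])
  obtain D q where D: "computes h B 2 D q (\<lambda>\<eta> key \<rho> s s'.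
      s' 1 = w \<eta> key \<rho> \<and> length (w \<eta> key \<rho>) \<le> poly q \<eta> \<and> (\<forall>i. i \<notin> B \<longrightarrow> s' i = s i))"
    by (rule computableE[OF w inf(2) mem(3,4)])
  show ?thesis
  proof (rule that[of "move 0 2 True ;; C ;; D" "[:1, 4:] + (p + q)"], intro allI impI)
    fix \<eta> \<rho> and key :: bits
    assume key: "length key = \<eta>"
    let ?orc = "\<lambda>m. h \<eta> m key"
    define s where "s = stack (init \<eta> [])"
    define s0 where "s0 = s(0 := [], 2 := replicate \<eta> True)"
    have s: "s 0 = replicate \<eta> True" "\<And>i. i \<noteq> 0 \<Longrightarrow> s i = []"
      by (auto simp: s_def stack_init)
    have 1: "runs ?orc \<rho> (move 0 2 True) (4 * \<eta> + 1) 0 s 0 s0"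
      using runs_move[of 0 2 ?orc \<rho> True s 0] by (simp add: s s0_def)
    have sA: "s0 2 = replicate \<eta> True" "\<forall>i\<in>A. s0 i = []"
      using mem(2) s by (auto simp: s0_def)
    obtain h1 s1 where s1: "runs ?orc \<rho> C (poly p \<eta>) 0 s0 h1 s1"
      "s1 0 = v \<eta> key \<rho> \<and> length (v \<eta> key \<rho>) \<le> poly p \<eta> \<and> (\<forall>i. i \<notin> A \<longrightarrow> s1 i = s0 i)"
      by (rule computesE[OF C key sA])
    have s1_out: "i \<notin> A \<Longrightarrow> s1 i = s0 i" for i using s1(2) by simp
    have sB: "s1 2 = replicate \<eta> True" "\<forall>i\<in>B. s1 i = []"
    proof -
      show "s1 2 = replicate \<eta> True" using s1_out mem(2) by (simp add: s0_def)
      show "\<forall>i\<in>B. s1 i = []"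
      proof
        fix i assume "i \<in> B"
        then have "i \<notin> A" "i \<noteq> 0" "i \<noteq> 2" using mem by auto
        then show "s1 i = []" using s1_out s by (simp add: s0_def)
      qed
    qed
    obtain h2 s2 where s2: "runs ?orc \<rho> D (poly q \<eta>) h1 s1 h2 s2"
      "s2 1 = w \<eta> key \<rho> \<and> length (w \<eta> key \<rho>) \<le> poly q \<eta> \<and> (\<forall>i. i \<notin> B \<longrightarrow> s2 i = s1 i)"
      by (rule computesE[OF D key sB])
    have "halts_with ?orc \<rho> (move 0 2 True ;; C ;; D) \<eta> [] (poly ([:1, 4:] + (p + q)) \<eta>) s2"
      by (rule runs_halts_with[OF runs_seq[OF 1[unfolded s_def] runs_seq[OF s1(1) s2(1)]]]) simp
    moreover have "s2 0 = v \<eta> key \<rho>"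
    proof -
      have "0 \<notin> B" using mem by auto
      then show ?thesis using s1(2) s2(2) by simp
    qed
    ultimately show "\<exists>st. halts_with ?orc \<rho> (move 0 2 True ;; C ;; D) \<eta> []
        (poly ([:1, 4:] + (p + q)) \<eta>) st \<and> st 0 = v \<eta> key \<rho> \<and> st 1 = w \<eta> key \<rho>"
      using s2(2) by blast
  qed
qed

text \<open>The restriction to keys of length \<open>\<eta>\<close> matters: only for them does the
  block of \<open>k\<close> on the honest tape spell the whole key.\<close>

lemma computable_cong:
  assumes "\<And>\<eta> key \<rho>. length key = \<eta> \<Longrightarrow> v \<eta> key \<rho> = w \<eta> key \<rho>" "computable h v"
  shows "computable h w"
proof -
  have "computes h R E C p (\<lambda>\<eta> key \<rho> s s'. s' r = v \<eta> key \<rho> \<and> length (v \<eta> key \<rho>) \<le> poly p \<eta> \<and>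
          (\<forall>i. i \<notin> R \<longrightarrow> s' i = s i)) =
        computes h R E C p (\<lambda>\<eta> key \<rho> s s'. s' r = w \<eta> key \<rho> \<and> length (w \<eta> key \<rho>) \<le> poly p \<eta> \<and>
          (\<forall>i. i \<notin> R \<longrightarrow> s' i = s i))" for R E C p r
    unfolding computes_def using assms(1) by auto
  then show ?thesis
    using assms(2) by (simp add: computable_def)
qed

section \<open>Evaluation of terms\<close>

lemma symbol_sound:
  assumes M: "computational_model S M" and f: "(ss, s) \<in> fsym_profiles S f"
  shows "poly_time (args_dom ss) (fun_int M f)"
    and "xs \<in> args_dom ss \<eta> \<Longrightarrow> fun_int M f \<eta> xs \<in> sort_dom \<eta> s"
proof -
  let ?I = "fun_int M"
  have I: "?I TrueF \<eta> [] = [True]" "?I FalseF \<eta> [] = [False]" "?I ZeroF \<eta> [] = replicate \<eta> False"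
    "?I EqF \<eta> [x, y] = [x = y]" "?I IteF \<eta> [[True], x, y] = x" "?I IteF \<eta> [[False], x, y] = y"
    "length x = \<eta> \<Longrightarrow> length y = \<eta> \<Longrightarrow> ?I XorF \<eta> [x, y] = map2 (\<noteq>) x y" for \<eta> x y
    using M by (auto simp: computational_model_def standard_int_def)
  have "poly_time (args_dom ss) (?I f) \<and> (\<forall>xs\<in>args_dom ss \<eta>. ?I f \<eta> xs \<in> sort_dom \<eta> s)"
  proof (cases "f \<in> {TrueF, FalseF, ZeroF, EqF, IteF, XorF}")
    case False
    then show ?thesis using M f by (auto simp: computational_model_def)
  next
    case True
    then consider "f = TrueF" | "f = FalseF" | "f = ZeroF" | "f = EqF" | "f = IteF" | "f = XorF"
      by blast
    then show ?thesis
    proof cases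
      case 1
      then show ?thesis using f poly_time_const[of "?I TrueF" True] I(1)
        by (auto simp: args_dom_def)
    next
      case 2
      then show ?thesis using f poly_time_const[of "?I FalseF" False] I(2)
        by (auto simp: args_dom_def)
    next
      case 3
      then show ?thesis using f poly_time_zero[of "?I ZeroF"] I(3)
        by (auto simp: args_dom_def)
    next
      case 4
      then show ?thesis using f poly_time_eq[of "?I EqF" TermS TermS] I(4)
        by (auto dest!: args_domD)
    next
      case 5
      then show ?thesis using f poly_time_ite[of "?I IteF"] I(5,6)
        by (auto dest!: args_domD)
    next
      case 6
      then show ?thesis using f poly_time_xor[of "?I XorF"] I(7)
        by (auto dest!: args_domD)
    qed
  qed
  then show "poly_time (args_dom ss) (?I f)"
    and "xs \<in> args_dom ss \<eta> \<Longrightarrow> ?I f \<eta> xs \<in> sort_dom \<eta> s" by auto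
qed

lemma eval_sort_dom:
  assumes M: "computational_model S M"
  shows "has_sort S t s \<Longrightarrow> eval M \<eta> \<rho>1 \<rho>2 t \<in> sort_dom \<eta> s"
proof (induction rule: has_sort.induct)
  case (Name n)
  then show ?case by (simp add: name_block_def)
next
  case (Fun ss s f ts)
  have "map (eval M \<eta> \<rho>1 \<rho>2) ts \<in> args_dom ss \<eta>"
    using Fun.IH by (auto simp: args_dom_def list.rel_map elim: list.rel_mono_strong)
  then show ?case using symbol_sound(2)[OF M Fun.hyps(1)] by simp
next
  case (Att g ss s ts)
  have "map (eval M \<eta> \<rho>1 \<rho>2) ts \<in> args_dom ss \<eta>"
    using Att.IH by (auto simp: args_dom_def list.rel_map elim: list.rel_mono_strong)
  then show ?case using M Att.hyps(1) by (auto simp: computational_model_def)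
qed simp

lemma eval_args_dom:
  assumes "computational_model S M" "list_all2 (has_sort S) ts ss"
  shows "map (eval M \<eta> \<rho>1 \<rho>2) ts \<in> args_dom ss \<eta>"
  using assms(2) eval_sort_dom[OF assms(1)]
  by (auto simp: args_dom_def list.rel_map elim: list.rel_mono_strong)

text \<open>Inversion would leave the case \<open>Subsort\<close>; induction strips any number of
  such steps, at the price of the link between \<open>s\<close> and \<open>s'\<close>.\<close>

lemma has_sort_FunD:
  "has_sort S (Fun f ts) s \<Longrightarrow>
   \<exists>ss s'. (ss, s') \<in> fsym_profiles S f \<and> list_all2 (has_sort S) ts ss"
  by (induction "Fun f ts :: ('c, 'a, 'b) trm" s rule: has_sort.induct) (auto elim: list.rel_mono_strong)

lemma has_sort_AttD:
  "has_sort S (Att g ts) s \<Longrightarrow> list_all2 (has_sort S) ts (fst (att_profile S g))"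
  by (induction "Att g ts :: ('c, 'a, 'b) trm" s rule: has_sort.induct) (auto elim: list.rel_mono_strong)

lemma list_all2_has_sortD:
  "list_all2 (has_sort S) ts ss \<Longrightarrow> t \<in> set ts \<Longrightarrow> \<exists>s. has_sort S t s"
  by (auto simp: list_all2_conv_all_nth in_set_conv_nth)

section \<open>Dividing the tape of the adversary\<close>

primrec names :: "('n, 'f, 'g) trm \<Rightarrow> 'n set" where
  "names (Name n) = {n}"
| "names (Fun f ts) = \<Union> (set (map names ts))"
| "names (Att g ts) = \<Union> (set (map names ts))"

lemma finite_names: "finite (names t)"
  by (induction t) auto

text \<open>The adversary has a single tape. Modulo \<open>m + 2\<close> it is divided into one stream for each name
  other than the key, the stream \<open>m\<close> for the tape of the attacker symbols, and the stream
  \<open>m + 1\<close> for the unused positions of the honest tape. The bits of a name appear in reverse since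
  reading them pushes them on a stack.\<close>

definition stream_pos :: "('n :: countable, 'f, 'g) model \<Rightarrow> 'n \<Rightarrow> nat \<Rightarrow> nat \<Rightarrow> nat \<Rightarrow> nat" where
  "stream_pos M k m \<eta> i =
     (if \<exists>n. n \<noteq> k \<and> to_nat n < m \<and> i \<in> set (name_block M \<eta> n)
      then let n = (THE n. i \<in> set (name_block M \<eta> n))
           in to_nat n + (name_pos M \<eta> n + \<eta> - Suc i) * Suc (Suc m)
      else Suc m + i * Suc (Suc m))"

text \<open>The honest tape for which the computation of the adversary is an evaluation in the
  model: the hidden key on its own block, elsewhere a rearrangement of the tape of the
  adversary.\<close>

definition honest_tape ::
  "('n :: countable, 'f, 'g) model \<Rightarrow> 'n \<Rightarrow> nat \<Rightarrow> nat \<Rightarrow> bits \<Rightarrow> tape \<Rightarrow> tape" where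
  "honest_tape M k m \<eta> key \<rho> i =
     (if i \<in> set (name_block M \<eta> k) then key ! (i - name_pos M \<eta> k)
      else \<rho> (stream_pos M k m \<eta> i))"

definition attacker_tape :: "nat \<Rightarrow> tape \<Rightarrow> tape" where
  "attacker_tape m \<rho> = (\<lambda>i. \<rho> (i * Suc (Suc m) + m))"

lemma name_block_unique:
  assumes "computational_model S M" "i \<in> set (name_block M \<eta> n)" "i \<in> set (name_block M \<eta> n')"
  shows "n = n'"
  using assms unfolding computational_model_def by (meson disjoint_iff)

lemma stream_pos_name:
  assumes "computational_model S M" "n \<noteq> k" "to_nat n < m" "i \<in> set (name_block M \<eta> n)"
  shows "stream_pos M k m \<eta> i = to_nat n + (name_pos M \<eta> n + \<eta> - Suc i) * Suc (Suc m)"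
proof -
  have "(THE n. i \<in> set (name_block M \<eta> n)) = n"
    using assms name_block_unique by (intro the_equality) fastforce+
  then show ?thesis
    using assms by (auto simp: stream_pos_def)
qed

text \<open>The right-hand side is exactly the value of \<open>computable_read\<close>; the reversal
  within blocks in \<open>stream_pos\<close> is chosen for this.\<close>

lemma eval_name_streams:
  assumes M: "computational_model S M" "n \<noteq> k" "to_nat n < m"
  shows "eval M \<eta> (honest_tape M k m \<eta> key \<rho>) \<rho>2 (Name n) =
    map (\<lambda>i. \<rho> (to_nat n + (\<eta> - Suc i) * Suc (Suc m))) [0..<\<eta>]"
proof (rule nth_equalityI)
  fix i assume "i < length (eval M \<eta> (honest_tape M k m \<eta> key \<rho>) \<rho>2 (Name n))"
  then have i: "i < \<eta>" by (simp add: name_block_def)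
  let ?j = "name_pos M \<eta> n + i"
  have j: "?j \<in> set (name_block M \<eta> n)" using i by (simp add: name_block_def)
  then have "?j \<notin> set (name_block M \<eta> k)"
    using name_block_unique[OF M(1) j] M(2) by blast
  then have "honest_tape M k m \<eta> key \<rho> ?j = \<rho> (stream_pos M k m \<eta> ?j)"
    by (simp only: honest_tape_def if_False)
  then show "eval M \<eta> (honest_tape M k m \<eta> key \<rho>) \<rho>2 (Name n) ! i =
      map (\<lambda>i. \<rho> (to_nat n + (\<eta> - Suc i) * Suc (Suc m))) [0..<\<eta>] ! i"
    using i stream_pos_name[OF M j]
    by (simp add: name_block_def)
qed (simp add: name_block_def)

lemma eval_key_honest_tape:
  assumes "length key = \<eta>"
  shows "eval M \<eta> (honest_tape M k m \<eta> key \<rho>) \<rho>2 (Name k) = key"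
  by (rule nth_equalityI) (auto simp: honest_tape_def name_block_def assms)

text \<open>Induction on \<open>only_hash_key\<close> never reaches the key as a term of its own: it
  appears only in the case \<open>Key\<close>, where a query takes the place of its value.\<close>

lemma computable_eval:
  fixes M :: "('n :: countable, 'f, 'g) model"
  assumes M: "computational_model S M"
    and "only_hash_key k t" "\<exists>s. has_sort S t s" "\<forall>n\<in>names t. n \<noteq> k \<longrightarrow> to_nat n < m"
  shows "computable (model_hash M)
    (\<lambda>\<eta> key \<rho>. eval M \<eta> (honest_tape M k m \<eta> key \<rho>) (attacker_tape m \<rho>) t)"
  using assms(2-)
proof (induction rule: only_hash_key.induct)
  case (Name n)
  then have n: "to_nat n < m" by simp
  show ?case
    unfolding eval_name_streams[OF M Name.hyps n] by (rule computable_read)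
next
  case (Key t)
  obtain s where "has_sort S (HashT t (Name k)) s" using Key.prems by blast
  then have "\<exists>s. has_sort S t s"
    using has_sort_FunD list_all2_has_sortD[of S "[t, Name k]" _ t] by (metis list.set_intros(1))
  then have c: "computable (model_hash M)
      (\<lambda>\<eta> key \<rho>. eval M \<eta> (honest_tape M k m \<eta> key \<rho>) (attacker_tape m \<rho>) t)"
    using Key.IH Key.prems(2) by simp
  have "length (model_hash M \<eta> x key) = \<eta>" if "length key = \<eta>" for \<eta> x key
    using symbol_sound(2)[OF M, of "[TermS, NonceS]" NonceS HashF "[x, key]" \<eta>] that
    by (simp add: args_dom_def model_hash_def)
  note c' = computable_hash[OF c this]
  have "model_hash M \<eta> (eval M \<eta> (honest_tape M k m \<eta> key \<rho>) (attacker_tape m \<rho>) t) key =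
      eval M \<eta> (honest_tape M k m \<eta> key \<rho>) (attacker_tape m \<rho>) (HashT t (Name k))"
    if "length key = \<eta>" for \<eta> key \<rho>
    unfolding eval.simps(2) list.map model_hash_def eval_key_honest_tape[OF that] by (rule refl)
  then show ?case
    using c' by (rule computable_cong)
next
  \<comment> \<open>Hashes under other keys fall here and are computed by the program of
    \<open>HashF\<close>.\<close>
  case (Fun ts f)
  let ?v = "\<lambda>t \<eta> key \<rho>. eval M \<eta> (honest_tape M k m \<eta> key \<rho>) (attacker_tape m \<rho>) t"
  obtain s where "has_sort S (Fun f ts) s" using Fun.prems by blast
  then obtain ss s' where ss: "(ss, s') \<in> fsym_profiles S f" "list_all2 (has_sort S) ts ss"
    using has_sort_FunD by blast
  obtain P p where P: "oracle_free P" "coin_free P" "\<And>\<eta> xs. xs \<in> args_dom ss \<eta> \<Longrightarrow> \<exists>st.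
      halts_with (\<lambda>_. []) (\<lambda>_. False) P \<eta> xs (poly p (input_size \<eta> xs)) st \<and> st 0 = fun_int M f \<eta> xs"
    using symbol_sound(1)[OF M ss(1)] unfolding poly_time_def by blast
  have IH: "computable (model_hash M) v" if "v \<in> set (map ?v ts)" for v
    using that Fun.IH Fun.prems(2) list_all2_has_sortD[OF ss(2)] by fastforce
  have e: "map (\<lambda>v. v \<eta> key \<rho>) (map ?v ts) =
      map (eval M \<eta> (honest_tape M k m \<eta> key \<rho>) (attacker_tape m \<rho>)) ts" for \<eta> key \<rho>
    by simp
  have H: "\<exists>st. halts_with (\<lambda>_. []) (\<lambda>_. False) P \<eta> (map (\<lambda>v. v \<eta> key \<rho>) (map ?v ts))
      (poly p (input_size \<eta> (map (\<lambda>v. v \<eta> key \<rho>) (map ?v ts)))) st \<and> st 0 = ?v (Fun f ts) \<eta> key \<rho>"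
    for \<eta> key \<rho>
    unfolding e eval.simps by (rule P(3)[OF eval_args_dom[OF M ss(2)]])
  show ?case
  proof (rule computable_apply[where p = p and vs = "map ?v ts"])
    show "oracle_free P" by (rule P(1))
    \<comment> \<open>The program reads no coins, so the trivial stream with
      \<open>d = r = 0\<close> will do.\<close>
    show "0 \<le> (0 :: nat)" ..
    show "coin_free P \<and> (\<lambda>\<rho> _. False) = (\<lambda>\<rho> _. False) \<or>
        (\<lambda>\<rho> _. False) = (\<lambda>(\<rho> :: tape) i. \<rho> (i * Suc 0 + 0))"
      using P(2) by simp
  qed (erule IH, rule H)
next
  case (Att ts g)
  let ?v = "\<lambda>t \<eta> key \<rho>. eval M \<eta> (honest_tape M k m \<eta> key \<rho>) (attacker_tape m \<rho>) t"
  obtain s where "has_sort S (Att g ts) s" using Att.prems by blast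
  from has_sort_AttD[OF this] obtain ss s' where ss: "att_profile S g = (ss, s')"
      "list_all2 (has_sort S) ts ss"
    by (metis fst_conv surj_pair)
  have "poly_time_tape (args_dom ss) (att_int M g)"
    using M ss(1) by (auto simp: computational_model_def)
  then obtain P p where P: "oracle_free P" "\<And>\<eta> \<rho> xs. xs \<in> args_dom ss \<eta> \<Longrightarrow> \<exists>st.
      halts_with (\<lambda>_. []) \<rho> P \<eta> xs (poly p (input_size \<eta> xs)) st \<and> st 0 = att_int M g \<eta> xs \<rho>"
    unfolding poly_time_tape_def by blast
  have IH: "computable (model_hash M) v" if "v \<in> set (map ?v ts)" for v
    using that Att.IH Att.prems(2) list_all2_has_sortD[OF ss(2)] by fastforce
  have e: "map (\<lambda>v. v \<eta> key \<rho>) (map ?v ts) =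
      map (eval M \<eta> (honest_tape M k m \<eta> key \<rho>) (attacker_tape m \<rho>)) ts" for \<eta> key \<rho>
    by simp
  have H: "\<exists>st. halts_with (\<lambda>_. []) (attacker_tape m \<rho>) P \<eta> (map (\<lambda>v. v \<eta> key \<rho>) (map ?v ts))
      (poly p (input_size \<eta> (map (\<lambda>v. v \<eta> key \<rho>) (map ?v ts)))) st \<and> st 0 = ?v (Att g ts) \<eta> key \<rho>"
    for \<eta> key \<rho>
    unfolding e eval.simps by (rule P(2)[OF eval_args_dom[OF M ss(2)]])
  show ?case
  proof (rule computable_apply[where p = p and vs = "map ?v ts"])
    show "oracle_free P" by (rule P(1))
    \<comment> \<open>All attacker symbols share the stream of residue \<open>m\<close> modulo
      \<open>m + 2\<close>, hence \<open>d = Suc m\<close> and \<open>r = m\<close>.\<close>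
    show "m \<le> Suc m" by simp
    show "coin_free P \<and> attacker_tape m = (\<lambda>\<rho> _. False) \<or>
        attacker_tape m = (\<lambda>\<rho> i. \<rho> (i * Suc (Suc m) + m))"
      by (intro disjI2 ext) (simp add: attacker_tape_def)
  qed (erule IH, rule H)
qed


section \<open>Measurability and reindexing of random tapes\<close>

lemma space_coin_tape [simp]: "space coin_tape = UNIV"
  by (simp add: coin_tape_def space_PiM PiE_UNIV_domain)

lemma prob_space_coin_tape: "prob_space coin_tape"
  unfolding coin_tape_def by (intro prob_space_PiM) (rule measure_pmf.prob_space_axioms)

lemma measurable_coin [measurable]: "(\<lambda>\<rho>. \<rho> i) \<in> coin_tape \<rightarrow>\<^sub>M count_space UNIV"
proof -
  have "(\<lambda>\<rho>. \<rho> i) \<in> coin_tape \<rightarrow>\<^sub>M measure_pmf (pmf_of_set UNIV)"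
    unfolding coin_tape_def by (rule measurable_component_singleton) simp
  then show ?thesis by simp
qed

lemma measurable_into_coin_tape:
  assumes "\<And>i. (\<lambda>\<omega>. f \<omega> i) \<in> N \<rightarrow>\<^sub>M count_space UNIV"
  shows "f \<in> N \<rightarrow>\<^sub>M coin_tape"
  unfolding coin_tape_def
proof (rule measurable_PiM_single')
  fix i :: nat
  show "(\<lambda>\<omega>. f \<omega> i) \<in> N \<rightarrow>\<^sub>M measure_pmf (pmf_of_set UNIV)"
    using assms[of i] by simp
qed (simp add: PiE_UNIV_domain)

lemma measurable_discrete2:
  fixes f :: "'a \<Rightarrow> 'b :: countable" and g :: "'a \<Rightarrow> 'c :: countable"
  assumes "f \<in> N \<rightarrow>\<^sub>M count_space UNIV" "g \<in> N \<rightarrow>\<^sub>M count_space UNIV"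
  shows "(\<lambda>\<omega>. u (f \<omega>) (g \<omega>)) \<in> N \<rightarrow>\<^sub>M count_space UNIV"
  by (rule measurable_compose_countable[OF _ assms(1)], rule measurable_compose[OF assms(2)]) simp

lemma measurable_map_discrete:
  fixes X :: "'b \<Rightarrow> 'a \<Rightarrow> 'c :: countable"
  assumes "\<And>x. x \<in> set xs \<Longrightarrow> X x \<in> N \<rightarrow>\<^sub>M count_space UNIV"
  shows "(\<lambda>\<omega>. map (\<lambda>x. X x \<omega>) xs) \<in> N \<rightarrow>\<^sub>M count_space UNIV"
  using assms
proof (induction xs)
  case (Cons x xs)
  then show ?case
    using measurable_discrete2[of "X x" N "\<lambda>\<omega>. map (\<lambda>x. X x \<omega>) xs" Cons] by simp
qed simp

text \<open>Such a function factors through the prefix of length \<open>N\<close>, which takes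
  values in a countable type; \<open>g\<close> completes the prefix by \<open>False\<close>.\<close>

lemma measurable_finite_dependence:
  assumes "\<And>\<rho> \<rho>'. (\<And>i. i < N \<Longrightarrow> \<rho> i = \<rho>' i) \<Longrightarrow> f \<rho> = f \<rho>'"
  shows "f \<in> coin_tape \<rightarrow>\<^sub>M count_space UNIV"
proof -
  define g where "g l = f (\<lambda>i. i < N \<and> l ! i)" for l :: bits
  have "(\<lambda>\<rho>. g (map \<rho> [0..<N])) \<in> coin_tape \<rightarrow>\<^sub>M count_space UNIV"
    by (rule measurable_compose[OF measurable_map_discrete[of _ "\<lambda>i \<rho>. \<rho> i"]]) auto
  moreover have "g (map \<rho> [0..<N]) = f \<rho>" for \<rho>
    unfolding g_def by (rule assms) auto
  ultimately show ?thesis by simp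
qed

text \<open>The head advances by at most one position per step. Its bound is carried along to know
  which position the next step can read.\<close>

lemma steps_tape_cong:
  assumes "\<And>i. i < head c + T \<Longrightarrow> \<rho> i = \<rho>' i"
  shows "(step orc \<rho> P ^^ T) c = (step orc \<rho>' P ^^ T) c \<and> head ((step orc \<rho> P ^^ T) c) \<le> head c + T"
  using assms
proof (induction T)
  case (Suc T)
  let ?c = "(step orc \<rho> P ^^ T) c"
  have IH: "?c = (step orc \<rho>' P ^^ T) c" "head ?c \<le> head c + T"
    using Suc by auto
  have "step orc \<rho> P ?c = step orc \<rho>' P ?c \<and> head (step orc \<rho> P ?c) \<le> Suc (head ?c)"
    using IH(2) Suc.prems[of "head ?c"] by (cases "P ! pc ?c") (auto simp: step_def)
  then show ?case using IH by auto
qed simp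

lemma halts_with_tape_cong:
  assumes "\<And>i. i < T \<Longrightarrow> \<rho> i = \<rho>' i"
  shows "halts_with orc \<rho> P \<eta> xs T st \<longleftrightarrow> halts_with orc \<rho>' P \<eta> xs T st"
  using steps_tape_cong[of "init \<eta> xs" T \<rho> \<rho>' orc P] assms
  by (simp add: halts_with_def init_def)

lemma halts_with_unique:
  "halts_with orc \<rho> P \<eta> xs T st \<Longrightarrow> halts_with orc \<rho> P \<eta> xs T st' \<Longrightarrow> st = st'"
  by (simp add: halts_with_def Let_def)

lemma measurable_poly_time_tape:
  assumes "poly_time_tape D f" "xs \<in> D \<eta>"
  shows "(\<lambda>\<rho>. f \<eta> xs \<rho>) \<in> coin_tape \<rightarrow>\<^sub>M count_space UNIV"
proof -
  obtain P p where P: "\<And>\<rho>. \<exists>st.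
      halts_with (\<lambda>_. []) \<rho> P \<eta> xs (poly p (input_size \<eta> xs)) st \<and> st 0 = f \<eta> xs \<rho>"
    using assms unfolding poly_time_tape_def by blast
  show ?thesis
  proof (rule measurable_finite_dependence)
    fix \<rho> \<rho>' :: tape
    assume "\<And>i. i < poly p (input_size \<eta> xs) \<Longrightarrow> \<rho> i = \<rho>' i"
    then show "f \<eta> xs \<rho> = f \<eta> xs \<rho>'"
      using P[of \<rho>] P[of \<rho>'] halts_with_tape_cong halts_with_unique by metis
  qed
qed

lemma measurable_apply_poly_time_tape:
  assumes f: "poly_time_tape D f"
    and X: "X \<in> coin_tape \<Otimes>\<^sub>M coin_tape \<rightarrow>\<^sub>M count_space UNIV" "\<And>\<omega>. X \<omega> \<in> D \<eta>"
  shows "(\<lambda>\<omega>. f \<eta> (X \<omega>) (snd \<omega>)) \<in> coin_tape \<Otimes>\<^sub>M coin_tape \<rightarrow>\<^sub>M count_space UNIV"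
proof -
  \<comment> \<open>Measurability in the tape is known only for arguments in the domain, hence the
    default outside. As \<open>X\<close> has countably many values, they can be fixed one at a
    time.\<close>
  let ?f = "\<lambda>xs \<rho>. if xs \<in> D \<eta> then f \<eta> xs \<rho> else []"
  have "?f xs \<in> coin_tape \<rightarrow>\<^sub>M count_space UNIV" for xs
    using measurable_poly_time_tape[OF f, of xs] by (cases "xs \<in> D \<eta>") auto
  then have "(\<lambda>\<omega>. ?f xs (snd \<omega>)) \<in> coin_tape \<Otimes>\<^sub>M coin_tape \<rightarrow>\<^sub>M count_space UNIV" for xs
    by (rule measurable_compose[OF measurable_snd])
  then have "(\<lambda>\<omega>. ?f (X \<omega>) (snd \<omega>)) \<in> coin_tape \<Otimes>\<^sub>M coin_tape \<rightarrow>\<^sub>M count_space UNIV"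
    by (rule measurable_compose_countable[OF _ X(1)])
  then show ?thesis
    using X(2) by simp
qed

lemma measurable_eval:
  assumes M: "computational_model S M"
  shows "has_sort S t s \<Longrightarrow>
    (\<lambda>\<omega>. eval M \<eta> (fst \<omega>) (snd \<omega>) t) \<in> coin_tape \<Otimes>\<^sub>M coin_tape \<rightarrow>\<^sub>M count_space UNIV"
proof (induction rule: has_sort.induct)
  case (Name n)
  have "(\<lambda>\<rho>. map \<rho> (name_block M \<eta> n)) \<in> coin_tape \<rightarrow>\<^sub>M count_space UNIV"
    by (rule measurable_map_discrete[of _ "\<lambda>i \<rho>. \<rho> i"]) (rule measurable_coin)
  from measurable_compose[OF measurable_fst this] show ?case by simp
next
  case (Fun ss s f ts)
  have "(\<lambda>\<omega>. map (\<lambda>t. eval M \<eta> (fst \<omega>) (snd \<omega>) t) ts) \<in> coin_tape \<Otimes>\<^sub>M coin_tape \<rightarrow>\<^sub>M count_space UNIV"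
    using Fun.IH by (intro measurable_map_discrete) (auto simp: list_all2_conv_all_nth in_set_conv_nth)
  from measurable_compose[OF this, of "fun_int M f \<eta>" "count_space UNIV"] show ?case by simp
next
  case (Att g ss s ts)
  have m: "(\<lambda>\<omega>. map (\<lambda>t. eval M \<eta> (fst \<omega>) (snd \<omega>) t) ts) \<in> coin_tape \<Otimes>\<^sub>M coin_tape \<rightarrow>\<^sub>M count_space UNIV"
    using Att.IH by (intro measurable_map_discrete) (auto simp: list_all2_conv_all_nth in_set_conv_nth)
  have "list_all2 (has_sort S) ts ss"
    using Att.IH by (auto elim: list.rel_mono_strong)
  moreover have "poly_time_tape (args_dom ss) (att_int M g)"
    using M Att.hyps(1) by (auto simp: computational_model_def)
  ultimately show ?case
    using measurable_apply_poly_time_tape[OF _ m, of "args_dom ss" "att_int M g" \<eta>] eval_args_dom[OF M]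
    by simp
qed

text \<open>Disjoint families of coordinates of a product measure are independent, and an injective
  choice of coordinates is again a uniform tape.\<close>

lemma distr_coin_tape_pair:
  assumes a: "inj a" and b: "inj b" and disj: "range a \<inter> range b = {}"
  shows "distr coin_tape (coin_tape \<Otimes>\<^sub>M coin_tape) (\<lambda>\<rho>. (\<rho> \<circ> a, \<rho> \<circ> b)) =
    coin_tape \<Otimes>\<^sub>M coin_tape"
proof -
  interpret prob_space coin_tape by (rule prob_space_coin_tape)
  let ?B = "measure_pmf (pmf_of_set (UNIV :: bool set))"
  have comp: "random_variable ?B (\<lambda>\<rho>. \<rho> i)" for i
    using measurable_coin[of i] by simp
  have marg: "distr coin_tape coin_tape (\<lambda>\<rho>. \<rho> \<circ> c) = coin_tape" if "inj c" for c
    using distr_PiM_reindex[of UNIV "\<lambda>_. ?B" c UNIV] that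
    by (simp add: coin_tape_def measure_pmf.prob_space_axioms o_def restrict_UNIV)
  have "indep_vars (\<lambda>_. ?B) (\<lambda>i \<rho>. \<rho> i) UNIV"
  proof (subst indep_vars_iff_distr_eq_PiM)
    have "distr coin_tape ?B (\<lambda>\<rho>. \<rho> i) = ?B" for i
      unfolding coin_tape_def by (rule distr_PiM_component) (auto simp: measure_pmf.prob_space_axioms)
    then show "distr coin_tape (Pi\<^sub>M UNIV (\<lambda>_. ?B)) (\<lambda>x. \<lambda>i\<in>UNIV. x i) =
        (\<Pi>\<^sub>M i\<in>UNIV. distr coin_tape ?B (\<lambda>\<rho>. \<rho> i))"
      by (simp add: restrict_UNIV coin_tape_def[symmetric] distr_id2)
  qed (use comp in auto)
  from indep_var_restrict[OF this disj]
  have ind: "indep_var (PiM (range a) (\<lambda>_. ?B)) (\<lambda>\<rho>. restrict \<rho> (range a))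
      (PiM (range b) (\<lambda>_. ?B)) (\<lambda>\<rho>. restrict \<rho> (range b))"
    by simp
  have meas: "(\<lambda>\<rho>. \<rho> \<circ> c) \<in> PiM (range c) (\<lambda>_. ?B) \<rightarrow>\<^sub>M coin_tape" for c :: "nat \<Rightarrow> nat"
  proof (rule measurable_into_coin_tape)
    fix i
    have "(\<lambda>\<rho>. \<rho> (c i)) \<in> PiM (range c) (\<lambda>_. ?B) \<rightarrow>\<^sub>M ?B"
      by (rule measurable_component_singleton) simp
    then show "(\<lambda>\<rho>. (\<rho> \<circ> c) i) \<in> PiM (range c) (\<lambda>_. ?B) \<rightarrow>\<^sub>M count_space UNIV"
      by simp
  qed
  have res: "(\<lambda>\<rho>. \<rho> \<circ> c) \<circ> (\<lambda>\<rho>. restrict \<rho> (range c)) = (\<lambda>\<rho> :: tape. \<rho> \<circ> c)" for c :: "nat \<Rightarrow> nat"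
    by (auto simp: fun_eq_iff)
  have "indep_var coin_tape (\<lambda>\<rho>. \<rho> \<circ> a) coin_tape (\<lambda>\<rho>. \<rho> \<circ> b)"
    using indep_var_compose[OF ind meas meas] unfolding res .
  then show ?thesis
    unfolding indep_var_distribution_eq by (simp add: marg a b)
qed

text \<open>On a countable type it suffices to compare singletons: a string of length
  \<open>n\<close> has weight \<open>(1 / 2) ^ n\<close> on both sides, any other string 0.\<close>

lemma distr_coin_tape_prefix:
  "distr coin_tape (measure_pmf (pmf_of_set {w. length w = n})) (\<lambda>\<rho>. map \<rho> [0..<n]) =
    measure_pmf (pmf_of_set {w. length w = n})"
proof (rule measure_eqI_countable)
  let ?L = "{w :: bits. length w = n}"
  have L: "?L = {w. set w \<subseteq> UNIV \<and> length w = n}" by simp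
  have fin: "finite ?L" "card ?L = 2 ^ n"
    unfolding L by (rule finite_lists_length_eq, simp) (subst card_lists_length_eq, auto)
  have ne: "?L \<noteq> {}" using Ex_list_of_length by auto
  have m: "(\<lambda>\<rho>. map \<rho> [0..<n]) \<in> coin_tape \<rightarrow>\<^sub>M count_space UNIV"
    by (rule measurable_map_discrete[of _ "\<lambda>i \<rho>. \<rho> i"]) (rule measurable_coin)
  fix w :: bits
  show "emeasure (distr coin_tape (measure_pmf (pmf_of_set ?L)) (\<lambda>\<rho>. map \<rho> [0..<n])) {w} =
      emeasure (measure_pmf (pmf_of_set ?L)) {w}"
  proof (cases "length w = n")
    case True
    let ?B = "measure_pmf (pmf_of_set (UNIV :: bool set))"
    have "map \<rho> [0..<n] = w \<longleftrightarrow> (\<forall>i<n. \<rho> i = w ! i)" for \<rho>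
      by (simp add: list_eq_iff_nth_eq True)
    then have v: "(\<lambda>\<rho>. map \<rho> [0..<n]) -` {w} =
        prod_emb UNIV (\<lambda>_. ?B) {..<n} (Pi\<^sub>E {..<n} (\<lambda>i. {w ! i}))"
      by (intro set_eqI) (simp only: vimage_singleton_eq prod_emb_iff restrict_PiE_iff, auto)
    have "emeasure coin_tape ((\<lambda>\<rho>. map \<rho> [0..<n]) -` {w}) = (\<Prod>i<n. emeasure ?B {w ! i})"
      unfolding coin_tape_def v by (rule emeasure_PiM_emb) (auto simp: measure_pmf.prob_space_axioms)
    also have "emeasure ?B {w ! i} = ennreal (1 / 2)" for i
      by (simp add: emeasure_pmf_single)
    then have "(\<Prod>i<n. emeasure ?B {w ! i}) = ennreal (1 / 2) ^ n"
      by simp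
    also have "\<dots> = ennreal ((1 / 2) ^ n)"
      by (rule ennreal_power) simp
    also have "\<dots> = emeasure (measure_pmf (pmf_of_set ?L)) {w}"
    proof -
      have "pmf (pmf_of_set ?L) w = (1 / 2) ^ n"
        unfolding pmf_of_set[OF ne fin(1)] using fin(2) True by (simp add: power_one_over)
      then show ?thesis by (simp only: emeasure_pmf_single)
    qed
    finally show ?thesis
      using m by (simp add: emeasure_distr)
  next
    case False
    then have "(\<lambda>\<rho>. map \<rho> [0..<n]) -` {w} = {}" by auto
    then show ?thesis
      using m False fin ne by (simp add: emeasure_distr emeasure_pmf_single pmf_of_set)
  qed
qed auto

lemma residue_unique:
  fixes a b x y q :: nat
  assumes "a + x * q = b + y * q" "a < q" "b < q"
  shows "a = b \<and> x = y"
proof -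
  have "(a + x * q) mod q = a" "(b + y * q) mod q = b"
    using assms(2,3) by simp_all
  then have "a = b" using assms(1) by simp
  then show ?thesis using assms by simp
qed

lemma stream_pos_cases:
  assumes "computational_model S M"
  obtains n where "n \<noteq> k" "to_nat n < m" "i \<in> set (name_block M \<eta> n)"
      "stream_pos M k m \<eta> i = to_nat n + (name_pos M \<eta> n + \<eta> - Suc i) * Suc (Suc m)"
  | "stream_pos M k m \<eta> i = Suc m + i * Suc (Suc m)"
proof (cases "\<exists>n. n \<noteq> k \<and> to_nat n < m \<and> i \<in> set (name_block M \<eta> n)")
  case True
  then show ?thesis using that(1) stream_pos_name[OF assms] by blast
next
  case False
  then have "stream_pos M k m \<eta> i = Suc m + i * Suc (Suc m)"
    unfolding stream_pos_def by (rule if_not_P)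
  then show ?thesis by (rule that(2))
qed

text \<open>The residue modulo \<open>m + 2\<close> determines the stream and so the name; the
  quotient then determines the position, as the subtraction is not truncated inside a block.\<close>

lemma inj_stream_pos:
  assumes M: "computational_model S M"
  shows "inj (stream_pos M k m \<eta>)"
proof (rule injI)
  fix i j assume e: "stream_pos M k m \<eta> i = stream_pos M k m \<eta> j"
  show "i = j"
  proof (cases rule: stream_pos_cases[OF M, of k m i \<eta>])
    case i: (1 n)
    show ?thesis
    proof (cases rule: stream_pos_cases[OF M, of k m j \<eta>])
      case j: (1 n')
      have "to_nat n = to_nat n' \<and>
          name_pos M \<eta> n + \<eta> - Suc i = name_pos M \<eta> n' + \<eta> - Suc j"
        using residue_unique[OF e[unfolded i(4) j(4)]] i(2) j(2) by auto
      then show ?thesis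
        using i(3) j(3) by (auto simp: name_block_def)
    next
      case j: 2
      show ?thesis
        using residue_unique[OF e[unfolded i(4) j]] i(2) by simp
    qed
  next
    case i: 2
    show ?thesis
    proof (cases rule: stream_pos_cases[OF M, of k m j \<eta>])
      case j: (1 n)
      show ?thesis
        using residue_unique[OF e[unfolded i j(4)]] j(2) by simp
    next
      case j: 2
      show ?thesis
        using residue_unique[OF e[unfolded i j]] by simp
    qed
  qed
qed

lemma stream_pos_not_attacker:
  assumes M: "computational_model S M"
  shows "stream_pos M k m \<eta> i \<noteq> j * Suc (Suc m) + m"
proof
  assume "stream_pos M k m \<eta> i = j * Suc (Suc m) + m"
  then have e: "stream_pos M k m \<eta> i = m + j * Suc (Suc m)" by (simp only: add.commute)
  show False
  proof (cases rule: stream_pos_cases[OF M, of k m i \<eta>])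
    case (1 n)
    then show False
      using residue_unique[OF e[unfolded 1(4)]] by simp
  next
    case 2
    then show False
      using residue_unique[OF e[unfolded 2]] by simp
  qed
qed

text \<open>Both distributions are images of a single random tape \<open>\<sigma>\<close>, whose even positions provide
  the key and whose odd positions provide the tape of the adversary.\<close>

lemma measure_adversary_view:
  fixes M :: "('n :: countable, 'f, 'g) model"
  assumes M: "computational_model S M"
    and F: "F \<in> sets (measure_pmf (pmf_of_set {w. length w = \<eta>}) \<Otimes>\<^sub>M coin_tape)"
    and E: "E \<in> sets (coin_tape \<Otimes>\<^sub>M coin_tape)"
    and FE: "\<And>key \<rho>. length key = \<eta> \<Longrightarrow>
      (key, \<rho>) \<in> F \<longleftrightarrow> (honest_tape M k m \<eta> key \<rho>, attacker_tape m \<rho>) \<in> E"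
  shows "measure (measure_pmf (pmf_of_set {w. length w = \<eta>}) \<Otimes>\<^sub>M coin_tape) F =
    measure (coin_tape \<Otimes>\<^sub>M coin_tape) E"
proof -
  let ?K = "measure_pmf (pmf_of_set {w :: bits. length w = \<eta>})"
  \<comment> \<open>\<open>a\<close> and \<open>b\<close> tell which positions of
    \<open>\<sigma>\<close> the honest tape and the attacker tape of the model are read
    from.\<close>
  define a where "a i = (if i \<in> set (name_block M \<eta> k) then 2 * (i - name_pos M \<eta> k)
    else 2 * stream_pos M k m \<eta> i + 1)" for i
  define b where "b i = 2 * (i * Suc (Suc m) + m) + 1" for i :: nat
  have "inj a"
  proof (rule injI)
    fix i j assume e: "a i = a j"
    have odd: "2 * x \<noteq> 2 * y + 1" "2 * y + 1 \<noteq> 2 * x" for x y :: nat by presburger+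
    show "i = j"
      using e injD[OF inj_stream_pos[OF M], of k m \<eta> i j] odd
      by (auto simp: a_def name_block_def split: if_splits)
  qed
  moreover have "inj b"
    by (rule injI) (auto simp: b_def dest!: residue_unique[where q = "Suc (Suc m)"] simp del: mult_Suc_right)
  moreover have "range a \<inter> range b = {}"
  proof -
    have "a i \<noteq> b j" for i j
    proof
      assume e: "a i = b j"
      have "2 * x \<noteq> 2 * y + 1" for x y :: nat by presburger
      then have "a i = 2 * stream_pos M k m \<eta> i + 1"
        using e unfolding a_def b_def by meson
      then have "stream_pos M k m \<eta> i = j * Suc (Suc m) + m"
        using e unfolding b_def by (metis add_right_cancel mult_left_cancel zero_neq_numeral)
      then show False using stream_pos_not_attacker[OF M] by blast
    qed
    then show ?thesis by auto
  qed
  ultimately have ab: "distr coin_tape (coin_tape \<Otimes>\<^sub>M coin_tape) (\<lambda>\<sigma>. (\<sigma> \<circ> a, \<sigma> \<circ> b)) =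
      coin_tape \<Otimes>\<^sub>M coin_tape"
    by (rule distr_coin_tape_pair)
  define c where "c i = 2 * i" for i :: nat
  define d where "d i = 2 * i + 1" for i :: nat
  have cd: "distr coin_tape (coin_tape \<Otimes>\<^sub>M coin_tape) (\<lambda>\<sigma>. (\<sigma> \<circ> c, \<sigma> \<circ> d)) =
      coin_tape \<Otimes>\<^sub>M coin_tape"
  proof (rule distr_coin_tape_pair)
    have "2 * x \<noteq> Suc (2 * y)" for x y :: nat by presburger
    then show "range c \<inter> range d = {}" by (auto simp: c_def d_def)
  qed (auto simp: c_def d_def inj_def)
  have re: "(\<lambda>\<sigma>. \<sigma> \<circ> f) \<in> coin_tape \<rightarrow>\<^sub>M coin_tape" for f :: "nat \<Rightarrow> nat"
    by (rule measurable_into_coin_tape) simp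
  have ab_m: "(\<lambda>\<sigma>. (\<sigma> \<circ> f, \<sigma> \<circ> g)) \<in> coin_tape \<rightarrow>\<^sub>M coin_tape \<Otimes>\<^sub>M coin_tape" for f g :: "nat \<Rightarrow> nat"
    by (rule measurable_Pair[OF re re])
  have pre: "(\<lambda>\<rho>. map \<rho> [0..<\<eta>]) \<in> coin_tape \<rightarrow>\<^sub>M ?K"
    using measurable_map_discrete[of "[0..<\<eta>]" "\<lambda>i \<rho>. \<rho> i" coin_tape, OF measurable_coin] by simp
  interpret T: prob_space coin_tape by (rule prob_space_coin_tape)
  let ?g = "\<lambda>(x, y). (map x [0..<\<eta>], y :: tape)"
  have g_m: "?g \<in> coin_tape \<Otimes>\<^sub>M coin_tape \<rightarrow>\<^sub>M ?K \<Otimes>\<^sub>M coin_tape"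
    unfolding case_prod_beta
    by (rule measurable_Pair[OF measurable_compose[OF measurable_fst pre] measurable_snd])
  \<comment> \<open>A uniform key is a prefix of a random tape, so the space of the collision
    experiment is an image of two independent tapes.\<close>
  have "?K \<Otimes>\<^sub>M coin_tape = distr coin_tape ?K (\<lambda>\<rho>. map \<rho> [0..<\<eta>]) \<Otimes>\<^sub>M distr coin_tape coin_tape (\<lambda>y. y)"
    by (simp add: distr_coin_tape_prefix distr_id2)
  also have "\<dots> = distr (coin_tape \<Otimes>\<^sub>M coin_tape) (?K \<Otimes>\<^sub>M coin_tape) ?g"
    by (rule pair_measure_distr[OF pre]) (simp_all add: distr_id2 T.sigma_finite_measure_axioms)
  finally have K: "?K \<Otimes>\<^sub>M coin_tape = distr (coin_tape \<Otimes>\<^sub>M coin_tape) (?K \<Otimes>\<^sub>M coin_tape) ?g" .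
  have spc: "space (coin_tape \<Otimes>\<^sub>M coin_tape) = UNIV" by (simp add: space_pair_measure)
  have G: "?g -` F \<in> sets (coin_tape \<Otimes>\<^sub>M coin_tape)"
    using measurable_sets[OF g_m F] by (simp add: spc)
  have "measure (?K \<Otimes>\<^sub>M coin_tape) F = measure (coin_tape \<Otimes>\<^sub>M coin_tape) (?g -` F)"
    by (subst K, subst measure_distr[OF g_m F]) (simp add: spc)
  also have "\<dots> = measure coin_tape ((\<lambda>\<sigma>. (\<sigma> \<circ> c, \<sigma> \<circ> d)) -` (?g -` F))"
    by (subst cd[symmetric], subst measure_distr[OF ab_m G]) simp
  also have "(\<lambda>\<sigma>. (\<sigma> \<circ> c, \<sigma> \<circ> d)) -` (?g -` F) = (\<lambda>\<sigma>. (\<sigma> \<circ> a, \<sigma> \<circ> b)) -` E"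
  proof -
    have "(map (\<sigma> \<circ> c) [0..<\<eta>], \<sigma> \<circ> d) \<in> F \<longleftrightarrow> (\<sigma> \<circ> a, \<sigma> \<circ> b) \<in> E" for \<sigma> :: tape
    proof -
      have "honest_tape M k m \<eta> (map (\<sigma> \<circ> c) [0..<\<eta>]) (\<sigma> \<circ> d) = \<sigma> \<circ> a"
        by (auto simp: fun_eq_iff honest_tape_def a_def c_def d_def name_block_def)
      moreover have "attacker_tape m (\<sigma> \<circ> d) = \<sigma> \<circ> b"
        by (simp add: fun_eq_iff attacker_tape_def b_def d_def)
      ultimately show ?thesis
        using FE[of "map (\<sigma> \<circ> c) [0..<\<eta>]" "\<sigma> \<circ> d"] by simp
    qed
    then show ?thesis by auto
  qed
  also have "measure coin_tape \<dots> = measure (coin_tape \<Otimes>\<^sub>M coin_tape) E"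
    by (subst ab[symmetric], subst measure_distr[OF ab_m E]) simp
  finally show ?thesis .
qed

section \<open>The collision event\<close>

lemma negligible_mono:
  assumes "negligible g" "\<And>\<eta>. \<bar>f \<eta>\<bar> \<le> \<bar>g \<eta>\<bar>"
  shows "negligible f"
  unfolding negligible_def
proof
  fix c
  have "\<forall>\<^sub>F \<eta> in sequentially. \<bar>g \<eta>\<bar> < 1 / real \<eta> ^ c"
    using assms(1) by (simp add: negligible_def)
  then show "\<forall>\<^sub>F \<eta> in sequentially. \<bar>f \<eta>\<bar> < 1 / real \<eta> ^ c"
    by (rule eventually_mono) (use assms(2) in \<open>meson order_le_less_trans\<close>)
qed

text \<open>The difference lemma of game-based proofs: \<open>A\<close> and \<open>B\<close> are
  each covered by the other together with \<open>C\<close>.\<close>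

lemma (in prob_space) abs_prob_diff_le:
  assumes "A \<in> events" "B \<in> events" "C \<in> events" "A - C = B - C"
  shows "\<bar>prob A - prob B\<bar> \<le> prob C"
proof -
  have "prob A \<le> prob (B \<union> C)" "prob B \<le> prob (A \<union> C)"
    using assms by (auto intro!: finite_measure_mono)
  moreover have "prob (B \<union> C) \<le> prob B + prob C" "prob (A \<union> C) \<le> prob A + prob C"
    using assms by (auto intro!: measure_Un_le)
  ultimately show ?thesis by linarith
qed

lemma accept_event:
  assumes M: "computational_model S M"
    and A: "poly_time_tape (\<lambda>\<eta>. {xs. length xs = length us}) A"
    and us: "\<forall>u\<in>set us. has_sort S u TermS"
  shows "{(\<rho>1, \<rho>2). A \<eta> (map (eval M \<eta> \<rho>1 \<rho>2) us) \<rho>2 = [True]} \<in> sets (coin_tape \<Otimes>\<^sub>M coin_tape)"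
proof -
  have "(\<lambda>\<omega>. map (\<lambda>u. eval M \<eta> (fst \<omega>) (snd \<omega>) u) us) \<in> coin_tape \<Otimes>\<^sub>M coin_tape \<rightarrow>\<^sub>M count_space UNIV"
    using us measurable_eval[OF M] by (intro measurable_map_discrete) blast
  from measurable_apply_poly_time_tape[OF A this, of \<eta>]
  have "(\<lambda>\<omega>. A \<eta> (map (\<lambda>u. eval M \<eta> (fst \<omega>) (snd \<omega>) u) us) (snd \<omega>))
      \<in> coin_tape \<Otimes>\<^sub>M coin_tape \<rightarrow>\<^sub>M count_space UNIV"
    by simp
  from measurable_sets[OF this, of "{[True]}"] show ?thesis
    by (simp add: vimage_def space_pair_measure case_prod_unfold)
qed

definition collision ::
  "('n, 'f, 'g) model \<Rightarrow> 'n \<Rightarrow> ('n, 'f, 'g) trm \<Rightarrow> ('n, 'f, 'g) trm \<Rightarrow> nat \<Rightarrow> (tape \<times> tape) set" where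
  "collision M k t t' \<eta> = {(\<rho>1, \<rho>2). eval M \<eta> \<rho>1 \<rho>2 t \<noteq> eval M \<eta> \<rho>1 \<rho>2 t' \<and>
     eval M \<eta> \<rho>1 \<rho>2 (HashT t (Name k)) = eval M \<eta> \<rho>1 \<rho>2 (HashT t' (Name k))}"

lemma has_sort_hash_name:
  "has_sort S t TermS \<Longrightarrow> has_sort S (HashT t (Name k)) NonceS"
  by (rule has_sort.Fun[of "[TermS, NonceS]"]) (auto intro: has_sort.Name)

lemma collision_event:
  assumes M: "computational_model S M" and t: "has_sort S t TermS" and t': "has_sort S t' TermS"
  shows "collision M k t t' \<eta> \<in> sets (coin_tape \<Otimes>\<^sub>M coin_tape)"
proof -
  let ?e = "\<lambda>t \<omega>. eval M \<eta> (fst \<omega>) (snd \<omega>) t"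
  note m = measurable_eval[OF M]
  have 1: "(\<lambda>\<omega>. ?e t \<omega> \<noteq> ?e t' \<omega>) \<in> coin_tape \<Otimes>\<^sub>M coin_tape \<rightarrow>\<^sub>M count_space UNIV"
    by (rule measurable_discrete2[OF m[OF t] m[OF t'], where u = "\<lambda>x y. x \<noteq> y"])
  have 2: "(\<lambda>\<omega>. ?e (HashT t (Name k)) \<omega> = ?e (HashT t' (Name k)) \<omega>)
      \<in> coin_tape \<Otimes>\<^sub>M coin_tape \<rightarrow>\<^sub>M count_space UNIV"
    by (rule measurable_discrete2[OF m[OF has_sort_hash_name[OF t]] m[OF has_sort_hash_name[OF t']],
          where u = "\<lambda>x y. x = y"])
  have "(\<lambda>\<omega>. ?e t \<omega> \<noteq> ?e t' \<omega> \<and> ?e (HashT t (Name k)) \<omega> = ?e (HashT t' (Name k)) \<omega>)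
      \<in> coin_tape \<Otimes>\<^sub>M coin_tape \<rightarrow>\<^sub>M count_space UNIV"
    by (rule measurable_discrete2[OF 1 2, where u = "\<lambda>p q. p \<and> q"])
  from measurable_sets[OF this, of "{True}"] show ?thesis
    by (simp add: vimage_def space_pair_measure case_prod_unfold collision_def)
qed

text \<open>Keys form a countable type, so the key can be fixed; then only the first
  \<open>T\<close> bits of the tape matter.\<close>

lemma halts_event:
  "{(key, \<rho>). \<exists>st. halts_with (orc key) \<rho> P \<eta> xs T st \<and> Q key st}
    \<in> sets (measure_pmf (p :: bits pmf) \<Otimes>\<^sub>M coin_tape)"
proof -
  let ?Q = "\<lambda>key \<rho>. \<exists>st. halts_with (orc key) \<rho> P \<eta> xs T st \<and> Q key st"
  have "?Q key \<in> coin_tape \<rightarrow>\<^sub>M count_space UNIV" for key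
  proof (rule measurable_finite_dependence)
    fix \<rho> \<rho>' :: tape
    assume "\<And>i. i < T \<Longrightarrow> \<rho> i = \<rho>' i"
    then show "?Q key \<rho> = ?Q key \<rho>'" using halts_with_tape_cong by blast
  qed
  then have 1: "(\<lambda>\<omega>. ?Q key (snd \<omega>)) \<in> measure_pmf p \<Otimes>\<^sub>M coin_tape \<rightarrow>\<^sub>M count_space UNIV" for key
    by (rule measurable_compose[OF measurable_snd])
  have 2: "fst \<in> measure_pmf p \<Otimes>\<^sub>M coin_tape \<rightarrow>\<^sub>M count_space UNIV"
    using measurable_fst[of "measure_pmf p" coin_tape] by simp
  have "(\<lambda>\<omega>. ?Q (fst \<omega>) (snd \<omega>)) \<in> measure_pmf p \<Otimes>\<^sub>M coin_tape \<rightarrow>\<^sub>M count_space UNIV"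
    by (rule measurable_compose_countable[OF 1 2])
  from measurable_sets[OF this, of "{True}"] show ?thesis
    by (simp add: vimage_def space_pair_measure case_prod_unfold)
qed

lemma negligible_collision:
  fixes M :: "('n :: countable, 'f, 'g) model"
  assumes M: "computational_model S M" and cr: "cr_hk (model_hash M)"
    and t: "has_sort S t TermS" "only_hash_key k t"
    and t': "has_sort S t' TermS" "only_hash_key k t'"
  shows "negligible (\<lambda>\<eta>. measure (coin_tape \<Otimes>\<^sub>M coin_tape) (collision M k t t' \<eta>))"
proof -
  have "finite (to_nat ` (names t \<union> names t'))"
    by (simp add: finite_names)
  \<comment> \<open>\<open>m\<close> exceeds the codes of all names in the two terms, so each name
    other than the key has a stream of its own.\<close>
  then obtain m where m: "\<forall>n\<in>names t \<union> names t'. to_nat n < m"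
    by (metis finite_nat_iff_bounded image_eqI lessThan_iff subsetD)
  let ?v = "\<lambda>t \<eta> key \<rho>. eval M \<eta> (honest_tape M k m \<eta> key \<rho>) (attacker_tape m \<rho>) t"
  let ?h = "model_hash M"
  have "computable ?h (?v t)" "computable ?h (?v t')"
    using computable_eval[OF M t(2), of m] computable_eval[OF M t'(2), of m] t(1) t'(1) m by blast+
  then obtain P and p :: "nat poly" where P: "\<forall>\<eta> (key :: bits) \<rho>. length key = \<eta> \<longrightarrow> (\<exists>st.
      halts_with (\<lambda>m. ?h \<eta> m key) \<rho> P \<eta> [] (poly p \<eta>) st \<and> st 0 = ?v t \<eta> key \<rho> \<and> st 1 = ?v t' \<eta> key \<rho>)"
    by (rule reduction_program)
  define F where "F \<eta> = {(key, \<rho>). \<exists>st. halts_with (\<lambda>m. ?h \<eta> m key) \<rho> P \<eta> [] (poly p \<eta>) st \<and>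
      st 0 \<noteq> st 1 \<and> ?h \<eta> (st 0) key = ?h \<eta> (st 1) key}" for \<eta>
  have "measure (measure_pmf (pmf_of_set {w. length w = \<eta>}) \<Otimes>\<^sub>M coin_tape) (F \<eta>) =
      measure (coin_tape \<Otimes>\<^sub>M coin_tape) (collision M k t t' \<eta>)" for \<eta>
  proof (rule measure_adversary_view[OF M])
    show "F \<eta> \<in> sets (measure_pmf (pmf_of_set {w. length w = \<eta>}) \<Otimes>\<^sub>M coin_tape)"
      unfolding F_def by (rule halts_event)
    show "collision M k t t' \<eta> \<in> sets (coin_tape \<Otimes>\<^sub>M coin_tape)"
      by (rule collision_event[OF M t(1) t'(1)])
    fix key :: bits and \<rho> :: tape
    assume key: "length key = \<eta>"
    obtain st where st: "halts_with (\<lambda>m. ?h \<eta> m key) \<rho> P \<eta> [] (poly p \<eta>) st"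
        "st 0 = ?v t \<eta> key \<rho>" "st 1 = ?v t' \<eta> key \<rho>"
      using P key by blast
    have "(key, \<rho>) \<in> F \<eta> \<longleftrightarrow> st 0 \<noteq> st 1 \<and> ?h \<eta> (st 0) key = ?h \<eta> (st 1) key"
      unfolding F_def mem_Collect_eq case_prod_conv using st(1) halts_with_unique[OF st(1)] by blast
    \<comment> \<open>The block of \<open>k\<close> on the honest tape holds \<open>key\<close>, so
      the oracle and the hash symbol give the same values.\<close>
    also have "\<dots> \<longleftrightarrow> (honest_tape M k m \<eta> key \<rho>, attacker_tape m \<rho>) \<in> collision M k t t' \<eta>"
      unfolding collision_def mem_Collect_eq case_prod_conv eval.simps(2) list.map
        eval_key_honest_tape[OF key] st(2,3) model_hash_def ..
    finally show "(key, \<rho>) \<in> F \<eta> \<longleftrightarrow>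
      (honest_tape M k m \<eta> key \<rho>, attacker_tape m \<rho>) \<in> collision M k t t' \<eta>" .
  qed
  moreover have "negligible (\<lambda>\<eta>. measure (measure_pmf (pmf_of_set {w. length w = \<eta>}) \<Otimes>\<^sub>M coin_tape) (F \<eta>))"
    unfolding F_def using cr unfolding cr_hk_def
    by (elim allE[of _ P] allE[of _ p] mp) (use P in blast)
  ultimately show ?thesis by simp
qed

text \<open>Equal arguments select the constant of the first branch; different ones have different
  hashes, as there is no collision.\<close>

lemma eval_guarded_hash_eq:
  assumes M: "computational_model S M" and "(\<rho>1, \<rho>2) \<notin> collision M k t t' \<eta>"
  shows "eval M \<eta> \<rho>1 \<rho>2 (IteT (EqT t t') FalseT (EqT (HashT t (Name k)) (HashT t' (Name k)))) =
    eval M \<eta> \<rho>1 \<rho>2 FalseT"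
proof -
  have I: "fun_int M FalseF \<eta> [] = [False]" "fun_int M EqF \<eta> [x, y] = [x = y]"
    "fun_int M IteF \<eta> [[True], x, y] = x" "fun_int M IteF \<eta> [[False], x, y] = y" for x y
    using M by (auto simp: computational_model_def standard_int_def)
  show ?thesis
    using assms(2) by (cases "eval M \<eta> \<rho>1 \<rho>2 t = eval M \<eta> \<rho>1 \<rho>2 t'") (simp_all add: collision_def I)
qed

theorem proposition2:
  fixes S :: "('f, 'g) signature"
    and M :: "('n :: countable, 'f, 'g) model"
    and k :: 'n
    and t t' :: "('n, 'f, 'g) trm"
    and us :: "('n, 'f, 'g) trm list"
  assumes "computational_model S M"
    and "cr_hk (model_hash M)"
    and "has_sort S t TermS" and "has_sort S t' TermS" and "\<forall>u\<in>set us. has_sort S u TermS"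
    and "only_hash_key k t" and "only_hash_key k t'" and "\<forall>u\<in>set us. only_hash_key k u"
  shows "indist M
           (us @ [IteT (EqT t t') FalseT (EqT (HashT t (Name k)) (HashT t' (Name k)))])
           (us @ [FalseT])"
proof -
  let ?t = "IteT (EqT t t') FalseT (EqT (HashT t (Name k)) (HashT t' (Name k)))"
  have sF: "has_sort S FalseT BoolS"
    by (rule has_sort.Fun[of "[]"]) auto
  have "has_sort S (EqT t t') BoolS"
    using assms(3,4) by (intro has_sort.Fun[of "[TermS, TermS]"]) auto
  moreover have "has_sort S (EqT (HashT t (Name k)) (HashT t' (Name k))) BoolS"
    using has_sort.Subsort[OF has_sort_hash_name[OF assms(3)]]
      has_sort.Subsort[OF has_sort_hash_name[OF assms(4)]]
    by (intro has_sort.Fun[of "[TermS, TermS]"]) auto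
  ultimately have "has_sort S ?t BoolS"
    using sF by (intro has_sort.Fun[of "[BoolS, BoolS, BoolS]"]) auto
  then have s: "\<forall>u\<in>set (us @ [?t]). has_sort S u TermS" "\<forall>u\<in>set (us @ [FalseT]). has_sort S u TermS"
    using assms(5) sF has_sort.Subsort by auto
  interpret pair_prob_space coin_tape coin_tape
    by (simp add: pair_prob_space_def pair_sigma_finite_def prob_space_coin_tape
        prob_space_imp_sigma_finite)
  have *: "negligible (\<lambda>\<eta>. \<bar>accept_prob M A (us @ [?t]) \<eta> - accept_prob M A (us @ [FalseT]) \<eta>\<bar>)"
    if A: "poly_time_tape (\<lambda>\<eta>. {xs. length xs = length (us @ [?t])}) A" for A
  proof (rule negligible_mono[OF negligible_collision[OF assms(1,2,3,6,4,7)]])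
    fix \<eta>
    have A': "poly_time_tape (\<lambda>\<eta>. {xs. length xs = length (us @ [FalseT])}) A"
      using A by simp
    have "\<bar>accept_prob M A (us @ [?t]) \<eta> - accept_prob M A (us @ [FalseT]) \<eta>\<bar> \<le>
        P.prob (collision M k t t' \<eta>)"
      unfolding accept_prob_def
    proof (rule P.abs_prob_diff_le)
      \<comment> \<open>Outside the collision event the distinguisher receives identical arguments
        on both sides and the same tape.\<close>
      show "{(\<rho>1, \<rho>2). A \<eta> (map (eval M \<eta> \<rho>1 \<rho>2) (us @ [?t])) \<rho>2 = [True]} - collision M k t t' \<eta> =
          {(\<rho>1, \<rho>2). A \<eta> (map (eval M \<eta> \<rho>1 \<rho>2) (us @ [FalseT])) \<rho>2 = [True]} - collision M k t t' \<eta>"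
        using eval_guarded_hash_eq[OF assms(1)] by (auto simp del: eval.simps)
    qed (intro accept_event[OF assms(1) A s(1)] accept_event[OF assms(1) A' s(2)]
        collision_event[OF assms(1,3,4)])+
    then show "\<bar>\<bar>accept_prob M A (us @ [?t]) \<eta> - accept_prob M A (us @ [FalseT]) \<eta>\<bar>\<bar> \<le>
        \<bar>P.prob (collision M k t t' \<eta>)\<bar>"
      by simp
  qed
  show ?thesis
    unfolding indist_def by (intro conjI allI impI) (simp, erule *)
qed

end
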